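(* Let $Z$ be the current iterate of the BPSD-id and $Z'$ the next iterate, computed with the preconditioner $K=(H-\sigma S)^{-1}$ for a certain $\sigma\in\big(\lambda_i,\,(\lambda_i+\lambda_{i+1})/2\big)$. Denote by $\theta_1\le\cdots\le\theta_{\widetilde k}$ and $\theta'_1\le\cdots\le\theta'_{\widetilde k}$ the Ritz values of $(H,S)$ in $\mathrm{span}\{Z\}$ and $\mathrm{span}\{Z'\}$, respectively. (a) If $\theta_1\neq\sigma$ and $\theta_1\in(\lambda_i,\lambda_{i+1})$, then $$\frac{\theta'_1-\lambda_i}{\lambda_{i+1}-\theta'_1}\le\left(\frac{\kappa}{2-\kappa}\right)^2\frac{\theta_1-\lambda_i}{\lambda_{i+1}-\theta_1}\quad\text{with}\quad \kappa=\left(\frac{\lambda_i-\sigma}{\lambda_{i+1}-\sigma}\right)\left(\frac{\lambda_n-\lambda_{i+1}}{\lambda_n-\lambda_i}\right).$$ (b) If $\theta_t\in(\lambda_j,\lambda_{j+1})$ for some $t\in\{2,\ldots,\widetilde k\}$ and $j=i-1+t$, then $$\frac{\theta'_t-\lambda_j}{\lambda_{j+1}-\theta'_t}\le\left(\frac{\kappa}{2-\kappa}\right)^2\frac{\theta_t-\lambda_j}{\lambda_{j+1}-\theta_t}\quad\text{with}\quad \kappa=\left(\frac{\lambda_j-\sigma}{\lambda_{j+1}-\sigma}\right)\left(\frac{\lambda_n-\lambda_{j+1}}{\lambda_n-\lambda_j}\right).$$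
   Context: Setting. $H,S\in\mathbb{C}^{n\times n}$ are Hermitian, $S$ is positive definite, and $\lambda_1\le\cdots\le\lambda_n$ are the (real) eigenvalues of the pair $(H,S)$, i.e. of $Hu=\lambda Su$. Fix an index $i$. Let $u_1,\ldots,u_n$ be an $S$-orthonormal basis of $\mathbb{C}^n$ with $Hu_l=\lambda_lSu_l$, and set $U=[u_1,\ldots,u_{i-1}]$ (the already computed eigenvectors, assumed exact) and $V=[u_i,\ldots,u_n]$; $\mathrm{span}\{V\}$ is the $S$-orthogonal complement of $\mathrm{span}\{U\}$. Here $\mathrm{span}\{\cdot\}$ denotes the span of all columns of the listed matrices. Ritz pairs. For a subspace with basis matrix $W$, the Ritz values of $(H,S)$ in it are the eigenvalues of the pair $(W^*HW,W^*SW)$ (counted with multiplicity), and the vectors $Wg$ with $g$ a corresponding eigenvector are the associated Ritz vectors. BPSD-id (block preconditioned steepest descent with implicit deflation), block size $\widetilde k$. Each iterate $Z\in\mathbb{C}^{n\times\widetilde k}$ has full rank, its columns belong to $\mathrm{span}\{V\}$, and they are $S$-orthonormal Ritz vectors of $(H,S)$ in $\mathrm{span}\{Z\}$ (so $Z^*SZ=I$ and $Z^*HZ$ is diagonal). With a Hermitian preconditioner $K\in\mathbb{C}^{n\times n}$, let $R=HZ-SZ(Z^*HZ)$ and $P=KR$. The next iterate $Z'$ consists of $S$-orthonormal Ritz vectors associated with the $i$th to the $(i-1+\widetilde k)$th smallest Ritz values of $(H,S)$ in $\mathrm{span}\{U,Z,P\}$, where the columns of $U$ serve as Ritz vectors for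 the $i-1$ smallest Ritz values and the columns of $Z'$ are $S$-orthogonal to them.
   Formalization: Part (b) is proved under the additional hypothesis θ_1 ≠ σ, which the source states only in (a); without it (b) fails, e.g. S=I, σ=0, i=1, H=[[0,0,1],[0,10,1],[1,1,10]], Z=[e1,e2], where κ=0 but θ'_2=θ_2=10. *)

theory Defs
  imports
    "Jordan_Normal_Form.DL_Rank"
    "Jordan_Normal_Form.Schur_Decomposition"
    "HOL-Combinatorics.Permutations"
begin

text \<open>
  Families such as \<open>lam\<close>, \<open>theta\<close>, \<open>u\<close> are functions on \<^typ>\<open>nat\<close> of which only the values at
  \<open>1, 2, \<dots>\<close> matter, so that indices agree with the usual mathematical notation. Matrix columns
  are numbered from 0 by the library: the first column of \<open>Z\<close> is \<open>col Z 0\<close>.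
\<close>

abbreviation cspan :: "nat \<Rightarrow> complex vec set \<Rightarrow> complex vec set" where
  "cspan n \<equiv> LinearCombinations.module.span class_ring (module_vec TYPE(complex) n)"

definition hermitian :: "complex mat \<Rightarrow> bool" where
  "hermitian A \<longleftrightarrow> square_mat A \<and> mat_adjoint A = A"

text \<open>\<open>w \<bullet>c v\<close> is linear in \<open>w\<close> and conjugates \<open>v\<close>, so \<open>(S *\<^sub>v v) \<bullet>c v\<close> is $v^*Sv$.\<close>

definition positive_definite :: "complex mat \<Rightarrow> bool" where
  "positive_definite S \<longleftrightarrow> hermitian S \<and>
     (\<forall>v \<in> carrier_vec (dim_row S). v \<noteq> 0\<^sub>v (dim_row S) \<longrightarrow> Re ((S *\<^sub>v v) \<bullet>c v) > 0)"

definition S_orthonormal :: "complex mat \<Rightarrow> complex mat \<Rightarrow> bool" where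
  "S_orthonormal S Z \<longleftrightarrow> mat_adjoint Z * S * Z = 1\<^sub>m (dim_col Z)"

definition pair_eigenvector ::
    "complex mat \<Rightarrow> complex mat \<Rightarrow> real \<Rightarrow> complex vec \<Rightarrow> bool" where
  "pair_eigenvector A B \<theta> g \<longleftrightarrow> g \<in> carrier_vec (dim_row A) \<and> g \<noteq> 0\<^sub>v (dim_row A) \<and>
     A *\<^sub>v g = complex_of_real \<theta> \<cdot>\<^sub>v (B *\<^sub>v g)"

text \<open>The polynomial $\det(xB - A)$.\<close>

definition pair_poly :: "complex mat \<Rightarrow> complex mat \<Rightarrow> complex poly" where
  "pair_poly A B = det ([:0, 1:] \<cdot>\<^sub>m map_mat (\<lambda>b. [:b:]) B + map_mat (\<lambda>a. [:- a:]) A)"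

text \<open>
  \<open>lam 1 \<le> \<dots> \<le> lam m\<close> are all eigenvalues of the \<open>m \<times> m\<close> pair \<open>(A, B)\<close>, counted with
  multiplicity. The definition is meant for Hermitian \<open>A\<close> and positive definite \<open>B\<close>, where the
  eigenvalues are real, \<^term>\<open>pair_poly A B\<close> is nonzero, and algebraic and geometric
  multiplicities coincide.
\<close>

definition pair_eigenvalues :: "complex mat \<Rightarrow> complex mat \<Rightarrow> (nat \<Rightarrow> real) \<Rightarrow> bool" where
  "pair_eigenvalues A B lam \<longleftrightarrow> mono_on {1..dim_row A} lam \<and>
     proots (pair_poly A B) = image_mset (\<lambda>l. complex_of_real (lam l)) (mset_set {1..dim_row A})"

definition basis_matrix :: "nat \<Rightarrow> complex mat \<Rightarrow> complex vec set \<Rightarrow> bool" where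
  "basis_matrix n W X \<longleftrightarrow> W \<in> carrier_mat n (dim_col W) \<and>
     vec_space.rank n W = dim_col W \<and> cspan n (set (cols W)) = X"

text \<open>
  Ritz values and Ritz pairs depend only on the subspace, not on the basis matrix, hence the
  existential quantifier over \<open>W\<close>.
\<close>

definition ritz_values ::
    "nat \<Rightarrow> complex mat \<Rightarrow> complex mat \<Rightarrow> complex vec set \<Rightarrow> (nat \<Rightarrow> real) \<Rightarrow> bool" where
  "ritz_values n H S X \<theta> \<longleftrightarrow> (\<exists>W. basis_matrix n W X \<and>
     pair_eigenvalues (mat_adjoint W * H * W) (mat_adjoint W * S * W) \<theta>)"

definition ritz_pair ::
    "nat \<Rightarrow> complex mat \<Rightarrow> complex mat \<Rightarrow> complex vec set \<Rightarrow> real \<Rightarrow> complex vec \<Rightarrow> bool" where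
  "ritz_pair n H S X \<theta> x \<longleftrightarrow> (\<exists>W g. basis_matrix n W X \<and>
     pair_eigenvector (mat_adjoint W * H * W) (mat_adjoint W * S * W) \<theta> g \<and> x = W *\<^sub>v g)"

definition S_orthonormal_eigenbasis ::
    "nat \<Rightarrow> complex mat \<Rightarrow> complex mat \<Rightarrow> (nat \<Rightarrow> real) \<Rightarrow> (nat \<Rightarrow> complex vec) \<Rightarrow> bool" where
  "S_orthonormal_eigenbasis n H S lam u \<longleftrightarrow>
     basis_matrix n (mat_of_cols n (map u [1..<Suc n])) (carrier_vec n) \<and>
     S_orthonormal S (mat_of_cols n (map u [1..<Suc n])) \<and>
     (\<forall>l\<in>{1..n}. pair_eigenvector H S (lam l) (u l))"

text \<open>
  Admissible iterates of block size \<open>k\<close>, where \<open>X\<close> is the \<open>S\<close>-orthogonal complement of the span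
  of the computed eigenvectors. That \<open>mat_adjoint Z * H * Z\<close> is diagonal is a consequence. The
  columns need not be sorted by their Ritz values.
\<close>

definition bpsd_id_iterate ::
    "nat \<Rightarrow> complex mat \<Rightarrow> complex mat \<Rightarrow> complex vec set \<Rightarrow> nat \<Rightarrow> complex mat \<Rightarrow> bool" where
  "bpsd_id_iterate n H S X k Z \<longleftrightarrow> Z \<in> carrier_mat n k \<and> vec_space.rank n Z = k \<and>
     set (cols Z) \<subseteq> X \<and> S_orthonormal S Z \<and>
     (\<forall>z \<in> set (cols Z). \<exists>\<tau>. ritz_pair n H S (cspan n (set (cols Z))) \<tau> z)"

text \<open>
  One step from \<open>Z\<close> to \<open>Z'\<close> with preconditioner \<open>K\<close>; the number \<open>dim_col U\<close> of computed
  eigenvectors is $i - 1$. The matrix $[U, Z, P]$ need not have full column rank, so the trial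
  subspace may have dimension smaller than \<open>dim_col U + 2 * dim_col Z\<close>. The permutation \<open>p\<close> leaves
  open in which order the new Ritz vectors are listed in \<open>Z'\<close>.
\<close>

definition bpsd_id_step ::
    "nat \<Rightarrow> complex mat \<Rightarrow> complex mat \<Rightarrow> complex mat \<Rightarrow> complex mat \<Rightarrow>
     complex mat \<Rightarrow> complex mat \<Rightarrow> bool" where
  "bpsd_id_step n H S K U Z Z' \<longleftrightarrow>
     (let k = dim_col Z;
          R = H * Z - S * Z * (mat_adjoint Z * H * Z);
          P = K * R;
          X = cspan n (set (cols U) \<union> set (cols Z) \<union> set (cols P))
      in hermitian K \<and> Z' \<in> carrier_mat n k \<and> S_orthonormal S Z' \<and>
         mat_adjoint U * S * Z' = 0\<^sub>m (dim_col U) k \<and>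
         (\<exists>\<mu> p. ritz_values n H S X \<mu> \<and> p permutes {1..k} \<and>
            (\<forall>l\<in>{1..dim_col U}. ritz_pair n H S X (\<mu> l) (col U (l - 1))) \<and>
            (\<forall>l\<in>{1..k}. ritz_pair n H S X (\<mu> (dim_col U + p l)) (col Z' (l - 1)))))"

end

(*
  In the eigenbasis u_1, ..., u_n the pencil is diagonal. If q is a Ritz vector in span Z with Ritz
  value theta <> sigma, then K(Hq - theta S q) = q - (theta - sigma) K S q, so span {U, Z, P} contains
  p(K S) q for every polynomial p of degree one. Ritz values theta_2, theta_3, ... are at least
  lambda_{i+1} > sigma by interlacing, hence theta_1 <> sigma covers all of them. Take for p the
  polynomial that is smallest on the eigenvalues 1/(lambda_l - sigma) of K S with l > j, that is, with
  root in the middle of their range: |p| <= a there and |p| >= b >= a for i <= l <= j, where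
  a/b = |kappa/(2 - kappa)|. The condition sigma < (lambda_i + lambda_{i+1})/2 gives the last bound for
  l = i, where 1/(lambda_l - sigma) is negative. Applying p(K S) to the first t Ritz vectors and adding
  span U gives a j-dimensional subspace of the trial space whose Rayleigh quotients are bounded term by
  term, and the Courant-Fischer principle bounds theta'_t by the largest of them.

  Coordinate vectors are indexed from 0, so entry l belongs to the eigenvalue lam (Suc l).
*)
theory Submission
  imports Defs "Jordan_Normal_Form.Spectral_Radius"
begin

section \<open>Hermitian forms and congruence\<close>

text \<open>Bounds on quotients cannot be compared term by term, so they are linearized. For
  lambda_j < theta < lambda_{j+1} and r = (theta - lambda_j) / (lambda_{j+1} - theta), a nonzero
  vector with coordinates x_l has Rayleigh quotient at most theta exactly when the sum of ((lambda_l
  - lambda_j) + r (lambda_l - lambda_{j+1})) |x_l|^2 is at most 0. The claim is the same inequality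
  for the filtered vector, with r multiplied by (a / b)^2. The weights are nonpositive for l <= j
  and nonnegative for l > j, so each term moves in the right direction.

  U enters unfiltered, because |p| need not reach b on the eigenvalues below lambda_i. The dimension
  of the trial space is unknown, so a Courant-Fischer bound must also deliver that enough Ritz
  values exist. Finally, the residual is formed with the columns of Z in any order and not with
  sorted Ritz vectors; a unitary N relates the two, and P N consists of the preconditioned residuals
  of the sorted ones.\<close>

lemma dim_mat_adjoint [simp]:
  "dim_row (mat_adjoint A) = dim_col A" "dim_col (mat_adjoint A) = dim_row A"
  by (simp_all add: mat_adjoint_def)

lemma mat_adjoint_carrier [simp]:
  "A \<in> carrier_mat nr nc \<Longrightarrow> mat_adjoint A \<in> carrier_mat nc nr"
  by (intro carrier_matI) auto

lemma index_mat_adjoint [simp]: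
  fixes A :: "complex mat"
  assumes "i < dim_col A" "j < dim_row A"
  shows "mat_adjoint A $$ (i, j) = cnj (A $$ (j, i))"
  using assms by (simp add: mat_adjoint_def mat_of_rows_index)

lemma mat_adjoint_mat_adjoint [simp]:
  fixes A :: "complex mat"
  shows "mat_adjoint (mat_adjoint A) = A"
  by (rule eq_matI) auto

lemma assoc_mult_mat_dim:
  fixes A B C :: "'a :: semiring_0 mat"
  assumes "dim_col A = dim_row B" "dim_col B = dim_row C"
  shows "A * B * C = A * (B * C)"
  by (rule assoc_mult_mat[of A "dim_row A" "dim_col A" B "dim_col B" C "dim_col C"])
    (use assms in auto)

lemma assoc_mult_mat_vec_dim:
  fixes A B :: "'a :: semiring_0 mat"
  assumes "dim_col A = dim_row B" "dim_col B = dim_vec v"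
  shows "A * B *\<^sub>v v = A *\<^sub>v (B *\<^sub>v v)"
  by (rule assoc_mult_mat_vec[of A "dim_row A" "dim_col A" B "dim_col B" v])
    (use assms in \<open>auto intro: carrier_vecI\<close>)

lemmas assoc_dim = assoc_mult_mat_dim assoc_mult_mat_vec_dim

lemma mat_adjoint_mult:
  fixes A B :: "complex mat"
  assumes "dim_col A = dim_row B"
  shows "mat_adjoint (A * B) = mat_adjoint B * mat_adjoint A"
  using assms
  by (intro eq_matI) (auto simp: scalar_prod_def mult.commute intro!: sum.cong)

lemma mat_adjoint_mult_vec:
  fixes A :: "complex mat"
  assumes A: "A \<in> carrier_mat a b" and v: "v \<in> carrier_vec a" and w: "w \<in> carrier_vec b"
  shows "(mat_adjoint A *\<^sub>v v) \<bullet>c w = v \<bullet>c (A *\<^sub>v w)"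
proof -
  have "(mat_adjoint A *\<^sub>v v) \<bullet>c w
      = (\<Sum>i<b. \<Sum>j<a. cnj (A $$ (j, i)) * v $ j * cnj (w $ i))"
    using A v w by (auto simp: scalar_prod_def sum_distrib_right lessThan_atLeast0 intro!: sum.cong)
  also have "\<dots> = (\<Sum>j<a. \<Sum>i<b. cnj (A $$ (j, i)) * v $ j * cnj (w $ i))"
    by (rule sum.swap)
  also have "\<dots> = v \<bullet>c (A *\<^sub>v w)"
    using A v w by (auto simp: scalar_prod_def sum_distrib_left lessThan_atLeast0 intro!: sum.cong)
  finally show ?thesis .
qed

lemma congruence_form:
  fixes A Q :: "complex mat"
  assumes "A \<in> carrier_mat n n" "Q \<in> carrier_mat n m" "c \<in> carrier_vec m" "d \<in> carrier_vec m"
  shows "((mat_adjoint Q * A * Q) *\<^sub>v c) \<bullet>c d = (A *\<^sub>v (Q *\<^sub>v c)) \<bullet>c (Q *\<^sub>v d)"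
proof -
  have "(mat_adjoint Q * A * Q) *\<^sub>v c = mat_adjoint Q *\<^sub>v (A *\<^sub>v (Q *\<^sub>v c))"
    using assms by (simp add: assoc_dim del: assoc_mult_mat assoc_mult_mat_vec)
  then show ?thesis
    using assms by (simp add: mat_adjoint_mult_vec[of _ n m])
qed

lemma index_congruence:
  fixes A Q :: "complex mat"
  assumes "A \<in> carrier_mat n n" "Q \<in> carrier_mat n m" "i < m" "j < m"
  shows "(mat_adjoint Q * A * Q) $$ (i, j) = (A *\<^sub>v col Q j) \<bullet>c col Q i"
proof -
  have *: "row (mat_adjoint Q) i = conjugate (col Q i)"
    using assms by (intro eq_vecI) auto
  have "(mat_adjoint Q * A * Q) $$ (i, j) = (mat_adjoint Q * (A * Q)) $$ (i, j)"
    using assms by (simp add: assoc_mult_mat[of _ m n _ n _ m])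
  also have "\<dots> = conjugate (col Q i) \<bullet> (A *\<^sub>v col Q j)"
    using assms index_mult_mat(1)[of i "mat_adjoint Q" j "A * Q"]
    unfolding * col_mult2[OF assms(1,2,4)] by simp
  also have "\<dots> = (A *\<^sub>v col Q j) \<bullet>c col Q i"
    using assms by (intro comm_scalar_prod[of _ n]) auto
  finally show ?thesis .
qed

lemma hermitian_congruence:
  assumes "A \<in> carrier_mat n n" "hermitian A" "Q \<in> carrier_mat n m"
  shows "hermitian (mat_adjoint Q * A * Q)"
  using assms
  by (auto simp: hermitian_def mat_adjoint_mult assoc_dim simp del: assoc_mult_mat)

lemma positive_definite_congruence:
  assumes A: "A \<in> carrier_mat n n" "positive_definite A" and Q: "Q \<in> carrier_mat n m"
    and inj: "\<And>c. c \<in> carrier_vec m \<Longrightarrow> Q *\<^sub>v c = 0\<^sub>v n \<Longrightarrow> c = 0\<^sub>v m"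
  shows "positive_definite (mat_adjoint Q * A * Q)"
  unfolding positive_definite_def
proof (intro conjI ballI impI)
  show "hermitian (mat_adjoint Q * A * Q)"
    using A Q by (auto simp: positive_definite_def intro: hermitian_congruence)
  fix v :: "complex vec"
  assume v: "v \<in> carrier_vec (dim_row (mat_adjoint Q * A * Q))"
    "v \<noteq> 0\<^sub>v (dim_row (mat_adjoint Q * A * Q))"
  then have "Q *\<^sub>v v \<noteq> 0\<^sub>v n" "v \<in> carrier_vec m" using Q inj by auto
  then show "0 < Re (((mat_adjoint Q * A * Q) *\<^sub>v v) \<bullet>c v)"
    using A Q by (auto simp: congruence_form[of _ n _ m] positive_definite_def)
qed

lemma hermitian_form_swap:
  assumes "A \<in> carrier_mat n n" "hermitian A" "x \<in> carrier_vec n" "y \<in> carrier_vec n"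
  shows "(A *\<^sub>v x) \<bullet>c y = cnj ((A *\<^sub>v y) \<bullet>c x)"
proof -
  have "(A *\<^sub>v x) \<bullet>c y = x \<bullet>c (A *\<^sub>v y)"
    using mat_adjoint_mult_vec[of A n n x y] assms by (simp add: hermitian_def)
  also have "\<dots> = cnj ((A *\<^sub>v y) \<bullet>c x)"
    using assms by (auto simp: scalar_prod_def mult.commute intro!: sum.cong)
  finally show ?thesis .
qed

lemma mult_diag_vec:
  assumes "c \<in> carrier_vec m" "l < m"
  shows "(mat_diag m f *\<^sub>v c) $ l = (f l :: complex) * c $ l"
  using assms
  by (simp add: mat_diag_def scalar_prod_def if_distrib[of "\<lambda>x. x * _"] cong: if_cong)

lemma diag_form:
  assumes "c \<in> carrier_vec m"
  shows "(mat_diag m (\<lambda>l. complex_of_real (d l)) *\<^sub>v c) \<bullet>c c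
    = complex_of_real (\<Sum>l<m. d l * (cmod (c $ l))\<^sup>2)"
proof -
  have "mat_diag m (\<lambda>l. complex_of_real (d l)) *\<^sub>v c \<in> carrier_vec m"
    by (rule mult_mat_vec_carrier[OF mat_diag_dim assms])
  then show ?thesis using assms
    by (auto simp: scalar_prod_def mult_diag_vec lessThan_atLeast0 complex_norm_square mult.assoc
        simp del: index_mult_mat_vec of_real_power intro!: sum.cong)
qed

lemma cscalar_self:
  assumes "c \<in> carrier_vec m"
  shows "c \<bullet>c c = complex_of_real (\<Sum>l<m. (cmod (c $ l))\<^sup>2)"
  using assms by (simp add: scalar_prod_def lessThan_atLeast0 complex_norm_square del: of_real_power)

section \<open>The Courant-Fischer bound in coordinates\<close>

text \<open>Padding \<open>A\<close> with zero rows to a square matrix makes row \<open>r\<close>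
  zero. The transpose then kills a unit vector, so the determinant vanishes and the padded matrix
  has a kernel vector.\<close>

lemma underdetermined_kernel:
  fixes A :: "complex mat"
  assumes A: "A \<in> carrier_mat r t" and "r < t"
  shows "\<exists>c \<in> carrier_vec t. c \<noteq> 0\<^sub>v t \<and> A *\<^sub>v c = 0\<^sub>v r"
proof -
  define B where "B = mat t t (\<lambda>(i, j). if i < r then A $$ (i, j) else 0)"
  have B: "B \<in> carrier_mat t t" by (simp add: B_def)
  have "transpose_mat B *\<^sub>v unit_vec t r = 0\<^sub>v t"
    using \<open>r < t\<close> by (auto simp: B_def scalar_prod_def unit_vec_def intro!: eq_vecI sum.neutral)
  moreover have "unit_vec t r \<noteq> (0\<^sub>v t :: complex vec)" using \<open>r < t\<close> by simp
  ultimately have "det (transpose_mat B) = 0"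
    using det_0_iff_vec_prod_zero[of "transpose_mat B" t] B unit_vec_carrier[of t r]
    by (meson transpose_carrier_mat)
  then have "det B = 0" using det_transpose[OF B] by simp
  then obtain c where c: "c \<in> carrier_vec t" "c \<noteq> 0\<^sub>v t" "B *\<^sub>v c = 0\<^sub>v t"
    using det_0_iff_vec_prod_zero[OF B] by auto
  have "A *\<^sub>v c = 0\<^sub>v r"
  proof (rule eq_vecI)
    fix i assume i: "i < dim_vec (0\<^sub>v r :: complex vec)"
    have "(B *\<^sub>v c) $ i = 0" using c(3) i \<open>r < t\<close> by simp
    moreover have "(B *\<^sub>v c) $ i = (A *\<^sub>v c) $ i"
      using i A c(1) \<open>r < t\<close> by (simp add: B_def scalar_prod_def)
    ultimately show "(A *\<^sub>v c) $ i = 0\<^sub>v r $ i" using i by simp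
  qed (use A in auto)
  then show ?thesis using c by auto
qed

text \<open>The range of \<open>Y\<close> contains a nonzero vector whose first \<open>t - 1\<close>
  coordinates vanish, and on it every weight that counts is at least \<open>\<theta> t\<close>. The
  conclusion \<open>t \<le> m\<close> comes along because the number of Ritz values of a trial space
  is not known beforehand.\<close>

lemma courant_fischer_coordinates:
  fixes \<theta> :: "nat \<Rightarrow> real"
  assumes Y: "Y \<in> carrier_mat m t" and t: "1 \<le> t" and mono: "mono_on {1..m} \<theta>"
    and inj: "\<And>c. c \<in> carrier_vec t \<Longrightarrow> Y *\<^sub>v c = 0\<^sub>v m \<Longrightarrow> c = 0\<^sub>v t"
    and bound: "\<And>c. c \<in> carrier_vec t \<Longrightarrow>
      (\<Sum>l<m. \<theta> (Suc l) * (cmod ((Y *\<^sub>v c) $ l))\<^sup>2) \<le> M * (\<Sum>l<m. (cmod ((Y *\<^sub>v c) $ l))\<^sup>2)"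
  shows "t \<le> m \<and> \<theta> t \<le> M"
proof -
  \<comment> \<open>The minimum lets one vector serve both conclusions: if \<open>t\<close> exceeded
    \<open>m\<close>, then \<open>r = m\<close>, and all coordinates of the nonzero \<open>y\<close>
    would vanish.\<close>
  define r where "r = min (t - 1) m"
  define A where "A = mat r t (\<lambda>(i, j). Y $$ (i, j))"
  have "A \<in> carrier_mat r t" "r < t" using t by (auto simp: A_def r_def)
  then obtain c where c: "c \<in> carrier_vec t" "c \<noteq> 0\<^sub>v t" "A *\<^sub>v c = 0\<^sub>v r"
    using underdetermined_kernel by blast
  define y where "y = Y *\<^sub>v c"
  have y: "y \<in> carrier_vec m" "y \<noteq> 0\<^sub>v m" using inj c Y by (auto simp: y_def)
  have y0: "y $ l = 0" if "l < r" for l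
  proof -
    have "(A *\<^sub>v c) $ l = 0" using c(3) that by simp
    moreover have "(A *\<^sub>v c) $ l = y $ l"
      using that Y c(1) by (simp add: A_def y_def scalar_prod_def r_def)
    ultimately show ?thesis by simp
  qed
  have "t \<le> m"
  proof (rule ccontr)
    assume "\<not> t \<le> m"
    then have "r = m" by (simp add: r_def)
    then have "y = 0\<^sub>v m" using y0 y(1) by (intro eq_vecI) auto
    with y(2) show False by simp
  qed
  then have r: "r = t - 1" by (simp add: r_def)
  have pos: "0 < (\<Sum>l<m. (cmod (y $ l))\<^sup>2)"
  proof -
    obtain l where "l < m" "y $ l \<noteq> 0"
      using y by (metis carrier_vecD eq_vecI index_zero_vec)
    then show ?thesis by (intro sum_pos2[of _ l]) auto
  qed
  have "\<theta> t * (\<Sum>l<m. (cmod (y $ l))\<^sup>2) \<le> (\<Sum>l<m. \<theta> (Suc l) * (cmod (y $ l))\<^sup>2)"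
    unfolding sum_distrib_left
  proof (rule sum_mono)
    fix l assume "l \<in> {..<m}"
    show "\<theta> t * (cmod (y $ l))\<^sup>2 \<le> \<theta> (Suc l) * (cmod (y $ l))\<^sup>2"
    proof (cases "l < r")
      case False
      then have "\<theta> t \<le> \<theta> (Suc l)"
        using \<open>l \<in> {..<m}\<close> r t by (intro mono_onD[OF mono]) auto
      then show ?thesis by (simp add: mult_right_mono)
    qed (simp add: y0)
  qed
  also have "\<dots> \<le> M * (\<Sum>l<m. (cmod (y $ l))\<^sup>2)"
    using bound[OF c(1)] by (simp add: y_def)
  finally have "\<theta> t \<le> M" using pos by simp
  with \<open>t \<le> m\<close> show ?thesis by simp
qed

section \<open>Simultaneous diagonalization of a definite pair\<close>

lemma pos_def_form:
  assumes "S \<in> carrier_mat n n" "positive_definite S" "v \<in> carrier_vec n" "v \<noteq> 0\<^sub>v n"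
  shows "0 < Re ((S *\<^sub>v v) \<bullet>c v)"
  using assms by (auto simp: positive_definite_def)

lemma hermitian_form_real:
  assumes "A \<in> carrier_mat n n" "hermitian A" "x \<in> carrier_vec n"
  shows "(A *\<^sub>v x) \<bullet>c x = complex_of_real (Re ((A *\<^sub>v x) \<bullet>c x))"
  using hermitian_form_swap[OF assms assms(3)] by (simp add: complex_eq_iff)

lemma mult_smult_vec:
  fixes A :: "complex mat"
  assumes "dim_vec v = dim_col A"
  shows "A *\<^sub>v (k \<cdot>\<^sub>v v) = k \<cdot>\<^sub>v (A *\<^sub>v v)"
  using assms by (intro mult_mat_vec[of A "dim_row A" "dim_col A"]) (auto intro: carrier_vecI)

lemma cscalar_smult:
  fixes v w :: "complex vec"
  assumes "dim_vec v = dim_vec w"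
  shows "(k \<cdot>\<^sub>v v) \<bullet>c w = k * (v \<bullet>c w)" "v \<bullet>c (k \<cdot>\<^sub>v w) = cnj k * (v \<bullet>c w)"
  using assms by (auto simp: scalar_prod_def sum_distrib_left ac_simps intro!: sum.cong)

text \<open>The inverse of \<open>B\<close> times \<open>A\<close> has an eigenvector over the
  complex numbers. Its eigenvalue is real because, after normalization, it is the value of the
  Hermitian form of \<open>A\<close> at \<open>g\<close>.\<close>

lemma pair_eigenvector_exists:
  assumes A: "A \<in> carrier_mat m m" "hermitian A" and B: "B \<in> carrier_mat m m" "positive_definite B"
    and "0 < m"
  shows "\<exists>g \<tau>. g \<in> carrier_vec m \<and> (B *\<^sub>v g) \<bullet>c g = 1 \<and> A *\<^sub>v g = complex_of_real \<tau> \<cdot>\<^sub>v (B *\<^sub>v g)"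
proof -
  have "det B \<noteq> 0"
  proof
    assume "det B = 0"
    then obtain v where v: "v \<in> carrier_vec m" "v \<noteq> 0\<^sub>v m" "B *\<^sub>v v = 0\<^sub>v m"
      using det_0_iff_vec_prod_zero[OF B(1)] by auto
    then have "(B *\<^sub>v v) \<bullet>c v = 0" by (simp add: scalar_prod_def)
    with pos_def_form[OF B v(1,2)] show False by simp
  qed
  then obtain C where C: "C \<in> carrier_mat m m" "B * C = 1\<^sub>m m"
    using det_non_zero_imp_unit[OF B(1), of "()"] by (auto simp: Units_def ring_mat_def)
  have "spectrum (C * A) \<noteq> {}"
    using spectrum_non_empty[of "C * A" m] A C \<open>0 < m\<close> by simp
  then obtain k v where v: "v \<in> carrier_vec m" "v \<noteq> 0\<^sub>v m" "(C * A) *\<^sub>v v = k \<cdot>\<^sub>v v"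
    using A C by (auto simp: spectrum_def eigenvalue_def eigenvector_def)
  have "A *\<^sub>v v = (B * C) *\<^sub>v (A *\<^sub>v v)"
    unfolding C(2) using A v by simp
  also have "\<dots> = B *\<^sub>v (k \<cdot>\<^sub>v v)"
    using A B C(1) v by (simp add: assoc_dim)
  finally have Av: "A *\<^sub>v v = k \<cdot>\<^sub>v (B *\<^sub>v v)"
    using v B by (simp add: mult_smult_vec)
  define r where "r = Re ((B *\<^sub>v v) \<bullet>c v)"
  have r: "0 < r" using pos_def_form[OF B v(1,2)] by (simp add: r_def)
  define g where "g = complex_of_real (1 / sqrt r) \<cdot>\<^sub>v v"
  have g: "g \<in> carrier_vec m" using v by (simp add: g_def)
  have hB: "hermitian B" using B by (simp add: positive_definite_def)
  have Bv: "(B *\<^sub>v v) \<bullet>c v = complex_of_real r"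
    unfolding r_def by (rule hermitian_form_real[OF B(1) hB v(1)])
  have "(B *\<^sub>v g) \<bullet>c g = complex_of_real (1 / sqrt r) * (complex_of_real (1 / sqrt r) * complex_of_real r)"
    using v B by (simp add: g_def mult_smult_vec cscalar_smult Bv del: of_real_divide)
  also have "\<dots> = complex_of_real (1 / sqrt r * (1 / sqrt r * r))" by (simp only: of_real_mult)
  also have "1 / sqrt r * (1 / sqrt r * r) = 1" using r by (simp add: field_simps)
  finally have Bg: "(B *\<^sub>v g) \<bullet>c g = 1" by simp
  have Ag: "A *\<^sub>v g = k \<cdot>\<^sub>v (B *\<^sub>v g)"
    using v A B by (simp add: g_def mult_smult_vec Av smult_smult_assoc mult.commute)
  have "(A *\<^sub>v g) \<bullet>c g = k"
    using g B Bg by (simp add: Ag cscalar_smult)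
  then have "k = complex_of_real (Re k)"
    using hermitian_form_real[OF A g] by simp
  then show ?thesis using g Bg Ag by metis
qed

text \<open>This supplies the deflation in the diagonalization below. Since \<open>f $ j\<close> is
  nonzero, orthogonality to \<open>f\<close> determines coordinate \<open>j\<close> from the other
  \<open>m\<close>, which \<open>insert_index j\<close> enumerates; each column of \<open>W\<close>
  sets one of these to 1 and the rest to 0.\<close>

lemma hyperplane_basis:
  fixes f :: "complex vec"
  assumes f: "f \<in> carrier_vec (Suc m)" "f \<noteq> 0\<^sub>v (Suc m)"
  shows "\<exists>W \<in> carrier_mat (Suc m) m. mat_adjoint W *\<^sub>v f = 0\<^sub>v m \<and>
    (\<forall>y \<in> carrier_vec m. W *\<^sub>v y = 0\<^sub>v (Suc m) \<longrightarrow> y = 0\<^sub>v m)"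
proof -
  obtain j where j: "j < Suc m" "f $ j \<noteq> 0"
    using f by (metis carrier_vecD eq_vecI index_zero_vec)
  define s where "s = insert_index j"
  have s: "s c \<noteq> j" "c < m \<Longrightarrow> s c < Suc m" "s c = s c' \<longleftrightarrow> c = c'" for c c'
    by (auto simp: s_def insert_index_def)
  define W where "W = mat (Suc m) m (\<lambda>(r, c). if r = j then - cnj (f $ s c) / cnj (f $ j)
    else if r = s c then 1 else 0)"
  have W: "W \<in> carrier_mat (Suc m) m" by (simp add: W_def)
  have "mat_adjoint W *\<^sub>v f = 0\<^sub>v m"
  proof (rule eq_vecI)
    fix c assume "c < dim_vec (0\<^sub>v m :: complex vec)"
    then have c: "c < m" by simp
    have "(mat_adjoint W *\<^sub>v f) $ c = (\<Sum>r<Suc m. cnj (W $$ (r, c)) * f $ r)"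
      using c f W by (auto simp: scalar_prod_def lessThan_atLeast0 simp del: sum.op_ivl_Suc intro!: sum.cong)
    also have "\<dots> = cnj (W $$ (j, c)) * f $ j + (\<Sum>r\<in>{..<Suc m} - {j}. cnj (W $$ (r, c)) * f $ r)"
      using j by (intro sum.remove) auto
    also have "(\<Sum>r\<in>{..<Suc m} - {j}. cnj (W $$ (r, c)) * f $ r)
        = (\<Sum>r\<in>{..<Suc m} - {j}. if s c = r then f $ r else 0)"
      using c by (intro sum.cong) (auto simp: W_def)
    also have "\<dots> = f $ s c" using s(1)[of c] s(2)[OF c] by (subst sum.delta') auto
    also have "cnj (W $$ (j, c)) * f $ j = - f $ s c" using j c by (simp add: W_def)
    finally show "(mat_adjoint W *\<^sub>v f) $ c = 0\<^sub>v m $ c" using c by simp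
  qed (use W in simp)
  moreover have "y = 0\<^sub>v m" if y: "y \<in> carrier_vec m" "W *\<^sub>v y = 0\<^sub>v (Suc m)" for y
  proof (rule eq_vecI)
    fix c assume "c < dim_vec (0\<^sub>v m :: complex vec)"
    then have c: "c < m" by simp
    have "(W *\<^sub>v y) $ s c = (\<Sum>c'<m. W $$ (s c, c') * y $ c')"
      using c s(2)[OF c] y(1) W by (simp add: scalar_prod_def lessThan_atLeast0)
    also have "\<dots> = (\<Sum>c'<m. if c = c' then y $ c' else 0)"
      using s(1)[of c] s(2)[OF c] by (intro sum.cong) (auto simp: W_def s(3))
    finally have "(W *\<^sub>v y) $ s c = y $ c" using c by simp
    then show "y $ c = 0\<^sub>v m $ c" using y(2) c s(2)[OF c] by simp
  qed (use y in simp)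
  ultimately show ?thesis using W by blast
qed

text \<open>Induction: split off an eigenvector \<open>g\<close> and restrict both forms to its
  \<open>B\<close>-orthogonal complement. That complement is orthogonal to \<open>g\<close> for the
  form of \<open>A\<close> as well, since \<open>A\<close> maps \<open>g\<close> to a multiple of
  its image under \<open>B\<close>; hence no off-diagonal entries appear.\<close>

lemma hermitian_pair_diagonalization:
  assumes "A \<in> carrier_mat m m" "hermitian A" "B \<in> carrier_mat m m" "positive_definite B"
  shows "\<exists>G \<in> carrier_mat m m. \<exists>d. mat_adjoint G * B * G = 1\<^sub>m m \<and>
    mat_adjoint G * A * G = mat_diag m (\<lambda>l. complex_of_real (d l))"
  using assms
proof (induction m arbitrary: A B)
  case 0
  have "mat_adjoint (1\<^sub>m 0) * B * 1\<^sub>m 0 = 1\<^sub>m 0"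
    "mat_adjoint (1\<^sub>m 0) * A * 1\<^sub>m 0 = mat_diag 0 (\<lambda>l. complex_of_real 0)"
    using 0 by (auto intro!: eq_matI simp: mat_diag_def)
  then show ?case by (intro bexI[of _ "1\<^sub>m 0"] exI[of _ "\<lambda>_. 0"]) auto
next
  case (Suc m)
  note A = Suc.prems(1,2) and B = Suc.prems(3,4)
  have hB: "hermitian B" using B by (simp add: positive_definite_def)
  obtain g \<tau> where g: "g \<in> carrier_vec (Suc m)" "(B *\<^sub>v g) \<bullet>c g = 1"
    and Ag: "A *\<^sub>v g = complex_of_real \<tau> \<cdot>\<^sub>v (B *\<^sub>v g)"
    using pair_eigenvector_exists[OF A B] by auto
  have Bg: "B *\<^sub>v g \<in> carrier_vec (Suc m)" using g(1) B(1) by (rule mult_mat_vec_carrier[rotated])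
  have "B *\<^sub>v g \<noteq> 0\<^sub>v (Suc m)" using g by (auto simp: scalar_prod_def)
  then obtain W where W: "W \<in> carrier_mat (Suc m) m" and Wg: "mat_adjoint W *\<^sub>v (B *\<^sub>v g) = 0\<^sub>v m"
    and inj: "\<And>y. y \<in> carrier_vec m \<Longrightarrow> W *\<^sub>v y = 0\<^sub>v (Suc m) \<Longrightarrow> y = 0\<^sub>v m"
    using hyperplane_basis[OF Bg] by blast
  have "hermitian (mat_adjoint W * A * W)" "positive_definite (mat_adjoint W * B * W)"
    using A B W inj by (auto intro: hermitian_congruence positive_definite_congruence)
  moreover have "mat_adjoint W * A * W \<in> carrier_mat m m" "mat_adjoint W * B * W \<in> carrier_mat m m"
    using W by (auto intro: carrier_matI)
  ultimately obtain G' d' where G': "G' \<in> carrier_mat m m"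
    and GB: "mat_adjoint G' * (mat_adjoint W * B * W) * G' = 1\<^sub>m m"
    and GA: "mat_adjoint G' * (mat_adjoint W * A * W) * G' = mat_diag m (\<lambda>l. complex_of_real (d' l))"
    using Suc.IH by blast
  define h where "h j = W *\<^sub>v col G' j" for j
  have h: "h j \<in> carrier_vec (Suc m)" for j using W G' unfolding h_def by (intro carrier_vecI) simp
  have hg: "(B *\<^sub>v h j) \<bullet>c g = 0" if "j < m" for j
  proof -
    have "cnj ((B *\<^sub>v h j) \<bullet>c g) = (mat_adjoint W *\<^sub>v (B *\<^sub>v g)) \<bullet>c col G' j"
      using hermitian_form_swap[OF B(1) hB h g(1)] mat_adjoint_mult_vec[OF W Bg, of "col G' j"] G' that
      by (simp add: h_def)
    also have "\<dots> = 0" using G' by (simp add: Wg scalar_prod_def)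
    finally show ?thesis by simp
  qed
  have gh: "(B *\<^sub>v g) \<bullet>c h j = 0" if "j < m" for j
    using hg[OF that] hermitian_form_swap[OF B(1) hB g(1) h] by simp
  have Agh: "(A *\<^sub>v g) \<bullet>c h j = 0" if "j < m" for j
    using gh[OF that] h[of j] B(1) by (simp add: Ag cscalar_smult carrier_vecD[OF h])
  have Ahg: "(A *\<^sub>v h j) \<bullet>c g = 0" if "j < m" for j
    using Agh[OF that] hermitian_form_swap[OF A h g(1)] by simp
  have hh: "(C *\<^sub>v h j) \<bullet>c h i = (mat_adjoint G' * (mat_adjoint W * C * W) * G') $$ (i, j)"
    if "C \<in> carrier_mat (Suc m) (Suc m)" "i < m" "j < m" for C i j
    using that W G' unfolding h_def
    by (subst index_congruence[of _ m], force, force, force, force)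
      (rule congruence_form[symmetric], auto)
  define G where "G = mat_of_cols (Suc m) (g # map h [0..<m])"
  have G: "G \<in> carrier_mat (Suc m) (Suc m)" by (intro carrier_matI) (auto simp: G_def)
  have col: "col G 0 = g" "j < m \<Longrightarrow> col G (Suc j) = h j" for j
    using g h by (auto simp: G_def)
  have "mat_adjoint G * B * G = 1\<^sub>m (Suc m)"
  proof (rule eq_matI)
    fix i j assume "i < dim_row (1\<^sub>m (Suc m) :: complex mat)" "j < dim_col (1\<^sub>m (Suc m) :: complex mat)"
    then have ij: "i < Suc m" "j < Suc m" by auto
    show "(mat_adjoint G * B * G) $$ (i, j) = 1\<^sub>m (Suc m) $$ (i, j)"
      unfolding index_congruence[OF B(1) G ij]
      using ij B(1) by (cases i; cases j) (auto simp: col g hg gh hh GB)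
  qed (use G in auto)
  moreover have "mat_adjoint G * A * G
      = mat_diag (Suc m) (\<lambda>l. complex_of_real ((case l of 0 \<Rightarrow> \<tau> | Suc l \<Rightarrow> d' l)))" (is "_ = ?D")
  proof (rule eq_matI)
    fix i j assume "i < dim_row ?D" "j < dim_col ?D"
    then have ij: "i < Suc m" "j < Suc m" by (auto simp: mat_diag_def)
    have "(A *\<^sub>v g) \<bullet>c g = complex_of_real \<tau>"
      using g B(1) by (simp add: Ag cscalar_smult)
    then show "(mat_adjoint G * A * G) $$ (i, j) = ?D $$ (i, j)"
      unfolding index_congruence[OF A(1) G ij]
      using ij A(1) by (cases i; cases j) (auto simp: col Ahg Agh hh GA mat_diag_def)
  qed (use G in \<open>auto simp: mat_diag_def\<close>)
  ultimately show ?case using G by blast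
qed

lemma poly_pair_poly:
  assumes "A \<in> carrier_mat m m" "B \<in> carrier_mat m m"
  shows "poly (pair_poly A B) x = det (x \<cdot>\<^sub>m B - A)"
  unfolding pair_poly_def by (rule poly_det_cong[of _ m]) (use assms in auto)

lemma det_mat_diag: "det (mat_diag m f) = (\<Prod>l<m. f l)"
proof -
  have "upper_triangular (mat_diag m f)" by (auto simp: mat_diag_def upper_triangular_def)
  then have "det (mat_diag m f) = prod_list (diag_mat (mat_diag m f))"
    by (rule det_upper_triangular[OF _ mat_diag_dim])
  also have "diag_mat (mat_diag m f) = map f [0..<m]"
    by (auto simp: diag_mat_def mat_diag_def intro!: nth_equalityI)
  finally show ?thesis
    by (simp add: prod.distinct_set_conv_list[symmetric] lessThan_atLeast0)
qed

text \<open>Congruence by \<open>G\<close> makes xB - A diagonal and multiplies its determinant by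
  the constant \<open>c\<close>, which is nonzero because \<open>B\<close> becomes the
  identity.\<close>

lemma proots_pair_poly:
  assumes A: "A \<in> carrier_mat m m" and B: "B \<in> carrier_mat m m" and G: "G \<in> carrier_mat m m"
    and GB: "mat_adjoint G * B * G = 1\<^sub>m m" and GA: "mat_adjoint G * A * G = mat_diag m d"
  shows "proots (pair_poly A B) = image_mset d (mset_set {..<m})"
proof -
  define c where "c = det (mat_adjoint G) * det G"
  have dt: "det (mat_adjoint G * X * G) = c * det X" if "X \<in> carrier_mat m m" for X
  proof -
    have "mat_adjoint G * X \<in> carrier_mat m m" using G that by (auto intro: carrier_matI)
    then show ?thesis using G that
      by (simp add: det_mult[of _ m] c_def)
  qed
  have "c \<noteq> 0" using dt[OF B] GB by auto
  have "smult c (pair_poly A B) = (\<Prod>l<m. [:- d l, 1:])"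
  proof (rule poly_ext)
    fix x
    have "mat_adjoint G * (x \<cdot>\<^sub>m B - A) * G = x \<cdot>\<^sub>m (mat_adjoint G * B * G) - mat_adjoint G * A * G"
    proof -
      have X: "mat_adjoint G \<in> carrier_mat m m" using G by simp
      have "mat_adjoint G * (x \<cdot>\<^sub>m B - A) = x \<cdot>\<^sub>m (mat_adjoint G * B) - mat_adjoint G * A"
        using A B X by (simp add: mult_minus_distrib_mat[of _ m m _ m] mult_smult_distrib[of _ m m _ m])
      moreover have "mat_adjoint G * B \<in> carrier_mat m m" "mat_adjoint G * A \<in> carrier_mat m m"
        using A B X by auto
      ultimately show ?thesis
        using G by (simp add: minus_mult_distrib_mat[of "x \<cdot>\<^sub>m (mat_adjoint G * B)" m m _ G m]
            mult_smult_assoc_mat[of "mat_adjoint G * B" m m G m] del: assoc_mult_mat)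
    qed
    also have "\<dots> = mat_diag m (\<lambda>l. x - d l)"
      unfolding GA GB by (rule eq_matI) (auto simp: mat_diag_def)
    finally have "c * det (x \<cdot>\<^sub>m B - A) = (\<Prod>l<m. x - d l)"
      using dt[OF minus_carrier_mat[OF A, of "x \<cdot>\<^sub>m B"]] by (simp add: det_mat_diag)
    then show "poly (smult c (pair_poly A B)) x = poly (\<Prod>l<m. [:- d l, 1:]) x"
      using A B by (simp add: poly_pair_poly poly_prod)
  qed
  moreover have "proots (\<Prod>l<m. [:- d l, 1:]) = (\<Sum>l<m. {#d l#})"
    by (subst proots_prod) auto
  moreover have "(\<Sum>l<m. {#d l#}) = image_mset d (mset_set {..<m})"
    by (induction m) (auto simp: lessThan_Suc)
  ultimately show ?thesis using \<open>c \<noteq> 0\<close> proots_smult[of c "pair_poly A B"] by simp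
qed

text \<open>A diagonalization lists the eigenvalues in an order of its own. Equality of the root
  multisets yields a permutation, multiplicities included, and permuting the columns of
  \<open>G\<close> realizes the prescribed enumeration \<open>lam\<close>.\<close>

lemma pair_eigenvalues_diagonalization:
  assumes A: "A \<in> carrier_mat m m" "hermitian A" and B: "B \<in> carrier_mat m m" "positive_definite B"
    and ev: "pair_eigenvalues A B lam"
  shows "\<exists>G \<in> carrier_mat m m. mat_adjoint G * B * G = 1\<^sub>m m \<and>
    mat_adjoint G * A * G = mat_diag m (\<lambda>l. complex_of_real (lam (Suc l)))"
proof -
  obtain G d where G: "G \<in> carrier_mat m m" and GB: "mat_adjoint G * B * G = 1\<^sub>m m"
    and GA: "mat_adjoint G * A * G = mat_diag m (\<lambda>l. complex_of_real (d l))"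
    using hermitian_pair_diagonalization[OF A B] by blast
  have "image_mset (\<lambda>l. complex_of_real (lam (Suc l))) (mset_set {..<m})
      = image_mset (\<lambda>l. complex_of_real (lam l)) (mset_set (Suc ` {..<m}))"
    by (subst image_mset_mset_set[symmetric]) (auto simp: multiset.map_comp o_def)
  also have "Suc ` {..<m} = {1..m}"
    by (auto simp: image_Suc_lessThan)
  also have "image_mset (\<lambda>l. complex_of_real (lam l)) (mset_set {1..m})
      = image_mset (\<lambda>l. complex_of_real (d l)) (mset_set {..<m})"
    using ev proots_pair_poly[OF A(1) B(1) G GB GA] A(1) by (simp add: pair_eigenvalues_def)
  finally obtain p where p: "p permutes {..<m}" "\<forall>x\<in>{..<m}. complex_of_real (lam (Suc x)) = complex_of_real (d (p x))"
    by (rule image_mset_eq_implies_permutes[OF finite_lessThan]) auto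
  have pm: "p i < m \<longleftrightarrow> i < m" for i using permutes_in_image[OF p(1), of i] by simp
  have pi: "p i = p j \<longleftrightarrow> i = j" for i j using permutes_inj[OF p(1)] by (auto dest: injD)
  define F where "F = mat m m (\<lambda>(i, j). G $$ (i, p j))"
  have F: "F \<in> carrier_mat m m" by (simp add: F_def)
  have col: "col F j = col G (p j)" if "j < m" for j
    using that G pm by (intro eq_vecI) (auto simp: F_def)
  have ent: "(mat_adjoint F * C * F) $$ (i, j) = (mat_adjoint G * C * G) $$ (p i, p j)"
    if "C \<in> carrier_mat m m" "i < m" "j < m" for C i j
    using that F G pm by (simp add: index_congruence[of _ m _ m] col del: index_mult_mat)
  have "mat_adjoint F * B * F = 1\<^sub>m m"
    by (rule eq_matI) (use F B in \<open>auto simp: ent GB pm pi simp del: index_mult_mat(1)\<close>)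
  moreover have "mat_adjoint F * A * F = mat_diag m (\<lambda>l. complex_of_real (lam (Suc l)))"
    by (rule eq_matI) (use F A p(2) in \<open>auto simp: ent GA mat_diag_def pm pi simp del: index_mult_mat(1)\<close>)
  ultimately show ?thesis using F by blast
qed

section \<open>Ritz values of subspaces\<close>

lemma cspan_cols:
  assumes "A \<in> carrier_mat n m"
  shows "cspan n (set (cols A)) = {A *\<^sub>v c | c. c \<in> carrier_vec m}"
proof -
  interpret vec_space "TYPE(complex)" n .
  show ?thesis
    using col_space_eq[OF assms] assms unfolding col_space_def by auto
qed

text \<open>Linear independence speaks of the set of columns, which forgets repetitions. Rank
  \<open>m\<close> forces this set to have \<open>m\<close> elements; only then does a nonzero
  kernel vector contradict its independence.\<close>

lemma full_rank_kernel:
  fixes W :: "complex mat"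
  assumes W: "W \<in> carrier_mat n m" and rank: "vec_space.rank n W = m"
    and c: "c \<in> carrier_vec m" "W *\<^sub>v c = 0\<^sub>v n"
  shows "c = 0\<^sub>v m"
proof (rule ccontr)
  assume "c \<noteq> 0\<^sub>v m"
  interpret vec_space "TYPE(complex)" n .
  obtain S where S: "maximal S (\<lambda>T. T \<subseteq> set (cols W) \<and> lin_indpt T)"
    using maximal_exists_superset[of "set (cols W)" "\<lambda>T. T \<subseteq> set (cols W) \<and> lin_indpt T" "{}"]
    by (auto simp: lin_dep_def)
  have "S \<subseteq> set (cols W)" using S by (auto simp: maximal_def)
  then have "m \<le> card (set (cols W))"
    using rank_card_indpt[OF W S] rank by (metis List.finite_set card_mono)
  then have "distinct (cols W)"
    using W card_length[of "cols W"] by (intro card_distinct) auto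
  then show False
    using full_rank_lin_indpt[OF W rank] lin_depI[OF W c(1) \<open>c \<noteq> 0\<^sub>v m\<close> c(2)] by blast
qed

lemma factor_through_range:
  fixes Q E :: "complex mat"
  assumes Q: "Q \<in> carrier_mat n m" and E: "E \<in> carrier_mat n t"
    and col: "\<And>j. j < t \<Longrightarrow> col E j \<in> {Q *\<^sub>v c | c. c \<in> carrier_vec m}"
  shows "\<exists>Y \<in> carrier_mat m t. E = Q * Y"
proof -
  have "\<forall>j. \<exists>c. j < t \<longrightarrow> c \<in> carrier_vec m \<and> col E j = Q *\<^sub>v c" using col by blast
  then obtain y where y: "\<And>j. j < t \<Longrightarrow> y j \<in> carrier_vec m \<and> col E j = Q *\<^sub>v y j" by metis
  define Y where "Y = mat_of_cols m (map y [0..<t])"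
  have Y: "Y \<in> carrier_mat m t" by (intro carrier_matI) (auto simp: Y_def)
  have "E = Q * Y"
  proof (rule eq_matI)
    fix i j assume ij: "i < dim_row (Q * Y)" "j < dim_col (Q * Y)"
    then have "j < t" "i < n" using Q Y by auto
    have "E $$ (i, j) = col E j $ i" using E \<open>i < n\<close> \<open>j < t\<close> by simp
    also have "\<dots> = (Q *\<^sub>v y j) $ i" using y \<open>j < t\<close> by simp
    also have "y j = col Y j" using y \<open>j < t\<close> by (simp add: Y_def)
    finally show "E $$ (i, j) = (Q * Y) $$ (i, j)" using Q Y \<open>i < n\<close> \<open>j < t\<close> by simp
  qed (use Q Y E in auto)
  with Y show ?thesis by blast
qed

text \<open>The arbitrary basis matrix hidden in \<open>ritz_values\<close> is traded for an
  \<open>S\<close>-orthonormal basis in which \<open>H\<close> is diagonal, namely \<open>W\<close>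
  times its diagonalizing \<open>G\<close>. Every later use of Ritz values goes through this
  form.\<close>

lemma ritz_values_diagonalization:
  assumes H: "H \<in> carrier_mat n n" "hermitian H" and S: "S \<in> carrier_mat n n" "positive_definite S"
    and ritz: "ritz_values n H S X \<theta>"
  shows "\<exists>m. \<exists>Q \<in> carrier_mat n m. mat_adjoint Q * S * Q = 1\<^sub>m m \<and>
    mat_adjoint Q * H * Q = mat_diag m (\<lambda>l. complex_of_real (\<theta> (Suc l))) \<and>
    X = {Q *\<^sub>v c | c. c \<in> carrier_vec m} \<and> mono_on {1..m} \<theta>"
proof -
  obtain W where W: "basis_matrix n W X"
    and ev: "pair_eigenvalues (mat_adjoint W * H * W) (mat_adjoint W * S * W) \<theta>"
    using ritz by (auto simp: ritz_values_def)
  define m where "m = dim_col W"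
  have Wc: "W \<in> carrier_mat n m" and rank: "vec_space.rank n W = m" and X: "cspan n (set (cols W)) = X"
    using W by (auto simp: basis_matrix_def m_def)
  have A: "mat_adjoint W * H * W \<in> carrier_mat m m" "hermitian (mat_adjoint W * H * W)"
    using Wc H by (auto intro: carrier_matI hermitian_congruence)
  have B: "mat_adjoint W * S * W \<in> carrier_mat m m" "positive_definite (mat_adjoint W * S * W)"
    using Wc S full_rank_kernel[OF Wc rank] by (auto intro: carrier_matI positive_definite_congruence)
  obtain G where G: "G \<in> carrier_mat m m" and GB: "mat_adjoint G * (mat_adjoint W * S * W) * G = 1\<^sub>m m"
    and GA: "mat_adjoint G * (mat_adjoint W * H * W) * G = mat_diag m (\<lambda>l. complex_of_real (\<theta> (Suc l)))"
    using pair_eigenvalues_diagonalization[OF A B ev] by blast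
  have eq: "mat_adjoint (W * G) * C * (W * G) = mat_adjoint G * (mat_adjoint W * C * W) * G"
    if "C \<in> carrier_mat n n" for C
    using that Wc G by (simp add: mat_adjoint_mult assoc_dim del: assoc_mult_mat)
  \<comment> \<open>\<open>G\<close> is square, so its left inverse is also a right inverse; this is
    why \<open>W * G\<close> has the whole range of \<open>W\<close>.\<close>
  have GI: "G * (mat_adjoint G * (mat_adjoint W * S * W)) = 1\<^sub>m m"
    by (rule mat_mult_left_right_inverse[OF mult_carrier_mat[OF mat_adjoint_carrier[OF G] B(1)] G GB])
  have "{W *\<^sub>v c | c. c \<in> carrier_vec m} = {(W * G) *\<^sub>v c | c. c \<in> carrier_vec m}"
  proof (intro equalityI subsetI; clarify)
    fix c :: "complex vec" assume c: "c \<in> carrier_vec m"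
    define c' where "c' = (mat_adjoint G * (mat_adjoint W * S * W)) *\<^sub>v c"
    have c': "c' \<in> carrier_vec m" unfolding c'_def using G by (intro carrier_vecI) simp
    have "G *\<^sub>v c' = (G * (mat_adjoint G * (mat_adjoint W * S * W))) *\<^sub>v c"
      unfolding c'_def using G Wc c
      by (intro assoc_mult_mat_vec_dim[symmetric]) auto
    then have "G *\<^sub>v c' = c" using c unfolding GI by simp
    then have "W *\<^sub>v c = (W * G) *\<^sub>v c'"
      using Wc G c' by (simp add: assoc_dim)
    then show "\<exists>ca. W *\<^sub>v c = W * G *\<^sub>v ca \<and> ca \<in> carrier_vec m" using c' by blast
  next
    fix c :: "complex vec" assume "c \<in> carrier_vec m"
    then have "W * G *\<^sub>v c = W *\<^sub>v (G *\<^sub>v c)" "G *\<^sub>v c \<in> carrier_vec m"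
      using Wc G by (auto simp: assoc_dim)
    then show "\<exists>ca. W * G *\<^sub>v c = W *\<^sub>v ca \<and> ca \<in> carrier_vec m" by blast
  qed
  then have "X = {(W * G) *\<^sub>v c | c. c \<in> carrier_vec m}"
    unfolding X[symmetric] cspan_cols[OF Wc] .
  moreover have "mono_on {1..m} \<theta>"
    using ev Wc by (simp add: pair_eigenvalues_def)
  moreover have "W * G \<in> carrier_mat n m" using Wc G by simp
  ultimately show ?thesis
    using eq[OF S(1)] eq[OF H(1)] GA GB by (intro exI[of _ m] bexI[of _ "W * G"]) simp_all
qed

lemma ritz_pair_mem:
  assumes "ritz_pair n H S X \<mu> x"
  shows "x \<in> X"
proof -
  obtain W g where W: "basis_matrix n W X" and x: "x = W *\<^sub>v g"
    and ev: "pair_eigenvector (mat_adjoint W * H * W) (mat_adjoint W * S * W) \<mu> g"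
    using assms by (auto simp: ritz_pair_def)
  have Wc: "W \<in> carrier_mat n (dim_col W)" and X: "cspan n (set (cols W)) = X"
    using W by (simp_all add: basis_matrix_def)
  have "g \<in> carrier_vec (dim_col W)" using ev by (simp add: pair_eigenvector_def)
  then show ?thesis unfolding X[symmetric] cspan_cols[OF Wc] x by blast
qed

text \<open>The Galerkin condition: the residual of a Ritz pair is orthogonal to the subspace. In
  this form no basis matrix is left.\<close>

lemma ritz_pair_form:
  assumes H: "H \<in> carrier_mat n n" and S: "S \<in> carrier_mat n n"
    and ritz: "ritz_pair n H S X \<mu> x" and y: "y \<in> X"
  shows "(H *\<^sub>v x) \<bullet>c y = complex_of_real \<mu> * ((S *\<^sub>v x) \<bullet>c y)"
proof -
  obtain W g where W: "basis_matrix n W X" and x: "x = W *\<^sub>v g"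
    and ev: "pair_eigenvector (mat_adjoint W * H * W) (mat_adjoint W * S * W) \<mu> g"
    using ritz by (auto simp: ritz_pair_def)
  define m where "m = dim_col W"
  have Wc: "W \<in> carrier_mat n m" using W by (simp add: basis_matrix_def m_def)
  have X: "X = {W *\<^sub>v c | c. c \<in> carrier_vec m}"
    unfolding cspan_cols[OF Wc, symmetric] using W by (simp add: basis_matrix_def)
  have g: "g \<in> carrier_vec m"
    "(mat_adjoint W * H * W) *\<^sub>v g = complex_of_real \<mu> \<cdot>\<^sub>v ((mat_adjoint W * S * W) *\<^sub>v g)"
    using ev Wc by (simp_all add: pair_eigenvector_def del: assoc_mult_mat assoc_mult_mat_vec)
  obtain c where c: "y = W *\<^sub>v c" "c \<in> carrier_vec m" using y X by auto
  have "(H *\<^sub>v x) \<bullet>c y = ((mat_adjoint W * H * W) *\<^sub>v g) \<bullet>c c"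
    unfolding x c(1) by (rule congruence_form[OF H Wc g(1) c(2), symmetric])
  also have "\<dots> = complex_of_real \<mu> * (((mat_adjoint W * S * W) *\<^sub>v g) \<bullet>c c)"
    unfolding g(2) using c Wc by (simp add: cscalar_smult)
  also have "((mat_adjoint W * S * W) *\<^sub>v g) \<bullet>c c = (S *\<^sub>v x) \<bullet>c y"
    unfolding x c(1) by (rule congruence_form[OF S Wc g(1) c(2)])
  finally show ?thesis .
qed

section \<open>Filtering by a polynomial of degree one\<close>

text \<open>Both summands of the weight have the same sign, nonpositive in the lower case and
  nonnegative in the upper one. The first is estimated by comparing the square of \<open>w\<close>
  with that of \<open>a\<close>, the second by comparing it with that of \<open>b\<close>, which the
  factor in front turns into that of \<open>a\<close>.\<close>

lemma weighted_term_bound: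
  fixes a b r l \<alpha> \<beta> w :: real
  assumes "0 \<le> a" "a \<le> b" "0 < b" "0 \<le> r" "\<alpha> < \<beta>"
    and w: "l \<le> \<alpha> \<and> b \<le> \<bar>w\<bar> \<or> \<beta> \<le> l \<and> \<bar>w\<bar> \<le> a"
  shows "((l - \<alpha>) + (a / b)\<^sup>2 * r * (l - \<beta>)) * w\<^sup>2 \<le> a\<^sup>2 * ((l - \<alpha>) + r * (l - \<beta>))"
proof -
  have ab: "(a / b)\<^sup>2 * b\<^sup>2 = a\<^sup>2" using \<open>0 < b\<close> by (simp add: power_divide)
  have a2b2: "a\<^sup>2 \<le> b\<^sup>2" using assms by (intro power_mono) auto
  from w show ?thesis
  proof
    assume l: "l \<le> \<alpha> \<and> b \<le> \<bar>w\<bar>"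
    then have w2: "b\<^sup>2 \<le> w\<^sup>2" using \<open>0 < b\<close> by (metis abs_of_pos abs_le_square_iff)
    have "(l - \<alpha>) * w\<^sup>2 \<le> (l - \<alpha>) * a\<^sup>2"
      using l w2 a2b2 by (intro mult_left_mono_neg) auto
    moreover have "(a / b)\<^sup>2 * r * (l - \<beta>) * w\<^sup>2 \<le> (a / b)\<^sup>2 * r * (l - \<beta>) * b\<^sup>2"
      using l w2 assms by (intro mult_left_mono_neg mult_nonneg_nonpos) auto
    moreover have "(a / b)\<^sup>2 * r * (l - \<beta>) * b\<^sup>2 = a\<^sup>2 * (r * (l - \<beta>))"
      using ab by (metis (no_types, lifting) mult.assoc mult.commute)
    ultimately show ?thesis by (simp add: algebra_simps)
  next
    assume l: "\<beta> \<le> l \<and> \<bar>w\<bar> \<le> a"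
    then have w2: "w\<^sup>2 \<le> a\<^sup>2" using \<open>0 \<le> a\<close> by (metis abs_of_nonneg abs_le_square_iff)
    have "(l - \<alpha>) * w\<^sup>2 \<le> (l - \<alpha>) * a\<^sup>2"
      using l w2 assms by (intro mult_left_mono) auto
    moreover have "(a / b)\<^sup>2 * r * (l - \<beta>) * w\<^sup>2 \<le> (a / b)\<^sup>2 * r * (l - \<beta>) * b\<^sup>2"
      using l order_trans[OF w2 a2b2] assms by (intro mult_left_mono) auto
    moreover have "(a / b)\<^sup>2 * r * (l - \<beta>) * b\<^sup>2 = a\<^sup>2 * (r * (l - \<beta>))"
      using ab by (metis (no_types, lifting) mult.assoc mult.commute)
    ultimately show ?thesis by (simp add: algebra_simps)
  qed
qed

section \<open>Rayleigh quotients under a coordinatewise filter\<close>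

lemma sum_lessThan_split:
  fixes f :: "nat \<Rightarrow> 'a :: comm_monoid_add"
  shows "(\<Sum>q<a + b. f q) = (\<Sum>q<a. f q) + (\<Sum>s<b. f (a + s))"
  by (induction b) (simp_all add: add.assoc)

lemma sum_norm_sq_eq_0:
  assumes "x \<in> carrier_vec n" "(\<Sum>l<n. (cmod (x $ l))\<^sup>2) \<le> 0"
  shows "x = 0\<^sub>v n"
proof (rule eq_vecI)
  fix l assume "l < dim_vec (0\<^sub>v n :: complex vec)"
  then have "l < n" by simp
  have "(\<Sum>l<n. (cmod (x $ l))\<^sup>2) = 0" using assms(2) by (simp add: sum_nonneg antisym)
  then have "(cmod (x $ l))\<^sup>2 = 0" using \<open>l < n\<close> by (subst (asm) sum_nonneg_eq_0_iff) auto
  then show "x $ l = 0\<^sub>v n $ l" using \<open>l < n\<close> by simp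
qed (use assms in simp)

text \<open>\<open>Y\<close> holds the eigenbasis coordinates of \<open>t\<close> vectors orthogonal
  to the deflated eigenvectors, with all Rayleigh quotients in their span at most
  \<open>\<theta>\<close>. \<open>w_low\<close> starts at \<open>i\<close> because the coordinates
  before that vanish in \<open>Y\<close>. Above \<open>j\<close> the filter is bounded only from
  above and may annihilate coordinates.\<close>

locale deflated_block =
  fixes n i j t :: nat and lam w :: "nat \<Rightarrow> real" and \<theta> a b :: real and Y :: "complex mat"
  assumes mono: "mono_on {1..n} lam" and i: "1 \<le> i" and t: "1 \<le> t" and j: "j = i - 1 + t" "j + 1 \<le> n"
    and \<theta>: "lam j < \<theta>" "\<theta> < lam (j + 1)"
    and ab: "0 \<le> a" "a \<le> b" "0 < b"
    and w_low: "\<And>l. l \<in> {i..j} \<Longrightarrow> b \<le> \<bar>w l\<bar>"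
    and w_high: "\<And>l. l \<in> {j + 1..n} \<Longrightarrow> \<bar>w l\<bar> \<le> a"
    and Y: "Y \<in> carrier_mat n t"
    and Y_zero: "\<And>c l. c \<in> carrier_vec t \<Longrightarrow> l < i - 1 \<Longrightarrow> (Y *\<^sub>v c) $ l = 0"
    and Y_kernel: "\<And>c. c \<in> carrier_vec t \<Longrightarrow> Y *\<^sub>v c = 0\<^sub>v n \<Longrightarrow> c = 0\<^sub>v t"
    and Y_bound: "\<And>c. c \<in> carrier_vec t \<Longrightarrow>
      (\<Sum>l<n. lam (Suc l) * (cmod ((Y *\<^sub>v c) $ l))\<^sup>2) \<le> \<theta> * (\<Sum>l<n. (cmod ((Y *\<^sub>v c) $ l))\<^sup>2)"
begin

text \<open>The coordinates of \<open>[U, p(KS) Q]\<close>, where \<open>Y\<close> are those of \<open>Q\<close> and \<open>w l\<close> is the value of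
  \<open>p\<close> at the \<open>l\<close>th eigenvalue.\<close>

definition deflated_filter :: "complex mat" where
  "deflated_filter = mat n j (\<lambda>(l, q). if q < i - 1 then (if l = q then 1 else 0)
     else complex_of_real (w (Suc l)) * Y $$ (l, q - (i - 1)))"

lemma deflated_filter_carrier: "deflated_filter \<in> carrier_mat n j"
  by (simp add: deflated_filter_def)

text \<open>The two blocks do not interact: the columns from \<open>U\<close> live on the
  coordinates below \<open>i - 1\<close>, where the range of \<open>Y\<close> vanishes.\<close>

lemma deflated_filter_mult:
  assumes c: "c \<in> carrier_vec j" and l: "l < n"
  defines "x \<equiv> Y *\<^sub>v vec t (\<lambda>s. c $ (i - 1 + s))"
  shows "(deflated_filter *\<^sub>v c) $ l = (if l < i - 1 then c $ l else complex_of_real (w (Suc l)) * x $ l)"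
proof -
  have ent1: "deflated_filter $$ (l, q) = (if l = q then 1 else 0)" if "q < i - 1" for q
  proof -
    have "q < j" using that j(1) by linarith
    then show ?thesis using that l by (simp add: deflated_filter_def)
  qed
  have ent2: "deflated_filter $$ (l, (i - 1) + s) = complex_of_real (w (Suc l)) * Y $$ (l, s)"
    if "s < t" for s
  proof -
    have "(i - 1) + s < j" using that j(1) by linarith
    then show ?thesis using l by (simp add: deflated_filter_def)
  qed
  have "(deflated_filter *\<^sub>v c) $ l = (\<Sum>q<j. deflated_filter $$ (l, q) * c $ q)"
    using c l deflated_filter_carrier by (simp add: scalar_prod_def lessThan_atLeast0)
  also have "\<dots> = (\<Sum>q<(i - 1) + t. deflated_filter $$ (l, q) * c $ q)"
    by (rule arg_cong[OF j(1)])
  also have "\<dots> = (\<Sum>q<i - 1. if l = q then c $ q else 0)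
      + (\<Sum>s<t. complex_of_real (w (Suc l)) * (Y $$ (l, s) * c $ (i - 1 + s)))"
    unfolding sum_lessThan_split
    by (intro arg_cong2[of _ _ _ _ "(+)"] sum.cong) (simp_all add: ent1 ent2 del: One_nat_def)
  also have "(\<Sum>s<t. complex_of_real (w (Suc l)) * (Y $$ (l, s) * c $ (i - 1 + s)))
      = complex_of_real (w (Suc l)) * x $ l"
    unfolding sum_distrib_left[symmetric] using Y l
    by (simp add: x_def scalar_prod_def lessThan_atLeast0)
  also have "(\<Sum>q<i - 1. if l = q then c $ q else 0) = (if l < i - 1 then c $ l else 0)"
    by simp
  finally show ?thesis using Y_zero[of "vec t (\<lambda>s. c $ (i - 1 + s))" l] by (simp add: x_def)
qed

lemma lam_less: "l < j \<Longrightarrow> lam (Suc l) \<le> lam j"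
  using j by (intro mono_onD[OF mono]) auto

lemma lam_greater: "j \<le> l \<Longrightarrow> l < n \<Longrightarrow> lam (j + 1) \<le> lam (Suc l)"
  using j by (intro mono_onD[OF mono]) auto

text \<open>Since the filter may vanish above \<open>j\<close>, injectivity needs the Rayleigh
  bound. A kernel vector makes \<open>x\<close> vanish on all coordinates below \<open>j\<close>, so
  its Rayleigh quotient would be at least \<open>lam (j + 1)\<close>, beyond
  \<open>\<theta>\<close>, unless \<open>x\<close> is zero.\<close>

lemma deflated_filter_kernel:
  assumes c: "c \<in> carrier_vec j" and Ec: "deflated_filter *\<^sub>v c = 0\<^sub>v n"
  shows "c = 0\<^sub>v j"
proof -
  define c'' where "c'' = vec t (\<lambda>s. c $ (i - 1 + s))"
  define x where "x = Y *\<^sub>v c''"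
  have c'': "c'' \<in> carrier_vec t" by (simp add: c''_def)
  have ent: "(if l < i - 1 then c $ l else complex_of_real (w (Suc l)) * x $ l) = 0" if "l < n" for l
  proof -
    have "(deflated_filter *\<^sub>v c) $ l = 0" using that by (simp add: Ec)
    then show ?thesis unfolding deflated_filter_mult[OF c that] x_def c''_def .
  qed
  have x0: "x $ l = 0" if "l < j" for l
  proof (cases "l < i - 1")
    case False
    then have "Suc l \<in> {i..j}" using that i by auto
    then have "w (Suc l) \<noteq> 0" using w_low[of "Suc l"] ab by auto
    moreover have "l < n" using that j by simp
    ultimately show ?thesis using ent[of l] False by simp
  qed (use Y_zero[OF c''] in \<open>simp add: x_def\<close>)
  have "lam (j + 1) * (\<Sum>l<n. (cmod (x $ l))\<^sup>2) \<le> (\<Sum>l<n. lam (Suc l) * (cmod (x $ l))\<^sup>2)"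
    unfolding sum_distrib_left
  proof (rule sum_mono)
    fix l assume "l \<in> {..<n}"
    then show "lam (j + 1) * (cmod (x $ l))\<^sup>2 \<le> lam (Suc l) * (cmod (x $ l))\<^sup>2"
      using x0[of l] lam_greater[of l] by (cases "l < j") (auto intro: mult_right_mono)
  qed
  also have "\<dots> \<le> \<theta> * (\<Sum>l<n. (cmod (x $ l))\<^sup>2)" using Y_bound[OF c''] by (simp add: x_def)
  finally have "(\<Sum>l<n. (cmod (x $ l))\<^sup>2) \<le> 0"
    using \<theta>(2) by (auto simp: mult_le_cancel_right)
  then have "x = 0\<^sub>v n"
    unfolding x_def by (intro sum_norm_sq_eq_0 mult_mat_vec_carrier[OF Y c''])
  then have c''0: "c'' = 0\<^sub>v t" using Y_kernel[OF c''] by (simp add: x_def)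
  show ?thesis
  proof (rule eq_vecI)
    fix q assume "q < dim_vec (0\<^sub>v j :: complex vec)"
    then have q: "q < j" by simp
    show "c $ q = 0\<^sub>v j $ q"
    proof (cases "q < i - 1")
      case True
      then show ?thesis using ent[of q] q j by simp
    next
      case False
      define s where "s = q - (i - 1)"
      have s: "s < t" "i - 1 + s = q" using False q j(1) unfolding s_def by linarith+
      have "c'' $ s = c $ q" unfolding c''_def using s by (simp del: One_nat_def)
      moreover have "c'' $ s = 0" using c''0 s(1) by simp
      ultimately show ?thesis using q by simp
    qed
  qed (use c in simp)
qed

text \<open>Both Rayleigh bounds are written as signs of weighted sums, with \<open>r\<close> for
  the vectors of \<open>Y\<close> and \<open>\<rho>\<close> for the filtered ones, and compared
  coordinate by coordinate. The factor in the conclusion is the number whose distances to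
  \<open>lam j\<close> and \<open>lam (j + 1)\<close> have the ratio \<open>\<rho>\<close>.\<close>

lemma deflated_filter_bound:
  assumes c: "c \<in> carrier_vec j"
  defines "\<rho> \<equiv> (a / b)\<^sup>2 * ((\<theta> - lam j) / (lam (j + 1) - \<theta>))"
  shows "(\<Sum>l<n. lam (Suc l) * (cmod ((deflated_filter *\<^sub>v c) $ l))\<^sup>2)
    \<le> (lam j + \<rho> * lam (j + 1)) / (1 + \<rho>) * (\<Sum>l<n. (cmod ((deflated_filter *\<^sub>v c) $ l))\<^sup>2)"
proof -
  define c'' where "c'' = vec t (\<lambda>s. c $ (i - 1 + s))"
  define x where "x = Y *\<^sub>v c''"
  have c'': "c'' \<in> carrier_vec t" by (simp add: c''_def)
  define r where "r = (\<theta> - lam j) / (lam (j + 1) - \<theta>)"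
  have r: "0 \<le> r" using \<theta> by (simp add: r_def)
  have "\<rho> = (a / b)\<^sup>2 * r" by (simp add: \<rho>_def r_def)
  then have \<rho>: "0 \<le> \<rho>" "\<rho> = (a / b)\<^sup>2 * r" using r by simp_all
  define e where "e l = cmod ((deflated_filter *\<^sub>v c) $ l)" for l
  have e: "e l = (if l < i - 1 then cmod (c $ l) else \<bar>w (Suc l)\<bar> * cmod (x $ l))" if "l < n" for l
    unfolding e_def deflated_filter_mult[OF c that] by (simp add: x_def c''_def norm_mult)
  have "((lam (Suc l) - lam j) + \<rho> * (lam (Suc l) - lam (j + 1))) * (e l)\<^sup>2
      \<le> a\<^sup>2 * ((lam (Suc l) - lam j) + r * (lam (Suc l) - lam (j + 1))) * (cmod (x $ l))\<^sup>2"
    if l: "l < n" for l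
  proof (cases "l < i - 1")
    \<comment> \<open>A coordinate contributed by \<open>U\<close> is arbitrary, but here the weight
      is nonpositive and the right-hand side is 0.\<close>
    case True
    then have "x $ l = 0" using Y_zero[OF c''] by (simp add: x_def)
    moreover have "lam (Suc l) \<le> lam j" using True j by (intro lam_less) simp
    then have "(lam (Suc l) - lam j) + \<rho> * (lam (Suc l) - lam (j + 1)) \<le> 0"
      using \<rho>(1) \<theta> by (intro add_nonpos_nonpos mult_nonneg_nonpos) auto
    then have "((lam (Suc l) - lam j) + \<rho> * (lam (Suc l) - lam (j + 1))) * (e l)\<^sup>2 \<le> 0"
      by (intro mult_nonpos_nonneg) auto
    ultimately show ?thesis by simp
  next
    case False
    have "lam (Suc l) \<le> lam j \<and> b \<le> \<bar>w (Suc l)\<bar> \<or> lam (j + 1) \<le> lam (Suc l) \<and> \<bar>w (Suc l)\<bar> \<le> a"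
    proof (cases "l < j")
      case True
      then show ?thesis using lam_less[OF True] w_low[of "Suc l"] False by auto
    next
      case False
      then show ?thesis using lam_greater[of l] l w_high[of "Suc l"] by auto
    qed
    then have "((lam (Suc l) - lam j) + \<rho> * (lam (Suc l) - lam (j + 1))) * (w (Suc l))\<^sup>2
      \<le> a\<^sup>2 * ((lam (Suc l) - lam j) + r * (lam (Suc l) - lam (j + 1)))"
      unfolding \<rho>(2) using ab r \<theta> by (intro weighted_term_bound) auto
    then have "((lam (Suc l) - lam j) + \<rho> * (lam (Suc l) - lam (j + 1))) * (w (Suc l))\<^sup>2 * (cmod (x $ l))\<^sup>2
      \<le> a\<^sup>2 * ((lam (Suc l) - lam j) + r * (lam (Suc l) - lam (j + 1))) * (cmod (x $ l))\<^sup>2"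
      by (rule mult_right_mono) simp
    then show ?thesis using e[OF l] False by (simp add: power_mult_distrib mult.assoc)
  qed
  then have "(\<Sum>l<n. ((lam (Suc l) - lam j) + \<rho> * (lam (Suc l) - lam (j + 1))) * (e l)\<^sup>2)
      \<le> (\<Sum>l<n. a\<^sup>2 * ((lam (Suc l) - lam j) + r * (lam (Suc l) - lam (j + 1))) * (cmod (x $ l))\<^sup>2)"
    by (intro sum_mono) auto
  \<comment> \<open>For this \<open>r\<close> the weight is a positive multiple of
    \<open>lam (Suc l) - \<theta>\<close>, so the Rayleigh bound on \<open>Y\<close> gives the sign
    of the sum.\<close>
  also have "(lam (Suc l) - lam j) + r * (lam (Suc l) - lam (j + 1))
      = (lam (j + 1) - lam j) / (lam (j + 1) - \<theta>) * (lam (Suc l) - \<theta>)" for l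
    using \<theta> by (simp add: r_def field_simps)
  then have "(\<Sum>l<n. a\<^sup>2 * ((lam (Suc l) - lam j) + r * (lam (Suc l) - lam (j + 1))) * (cmod (x $ l))\<^sup>2)
      = a\<^sup>2 * ((lam (j + 1) - lam j) / (lam (j + 1) - \<theta>)) *
        (\<Sum>l<n. (lam (Suc l) - \<theta>) * (cmod (x $ l))\<^sup>2)"
    by (simp add: sum_distrib_left mult.assoc)
  also have "\<dots> \<le> 0"
    using Y_bound[OF c''] \<theta>
    by (intro mult_nonneg_nonpos)
      (auto simp: x_def left_diff_distrib sum_subtractf sum_distrib_left)
  finally have "(\<Sum>l<n. ((lam (Suc l) - lam j) + \<rho> * (lam (Suc l) - lam (j + 1))) * (e l)\<^sup>2) \<le> 0" .
  also have "(\<Sum>l<n. ((lam (Suc l) - lam j) + \<rho> * (lam (Suc l) - lam (j + 1))) * (e l)\<^sup>2)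
      = (1 + \<rho>) * (\<Sum>l<n. lam (Suc l) * (e l)\<^sup>2) - (lam j + \<rho> * lam (j + 1)) * (\<Sum>l<n. (e l)\<^sup>2)"
    unfolding sum_distrib_left sum_subtractf[symmetric] by (intro sum.cong) (auto simp: algebra_simps)
  finally show ?thesis using \<rho>(1) by (simp add: e_def field_simps)
qed

end

text \<open>One linear condition on a two-dimensional space leaves a nonzero vector whose coordinate
  at \<open>i - 1\<close> also vanishes. It is supported where the eigenvalues are at least
  \<open>lam (i + 1)\<close>. Applied to the first two Ritz vectors, this keeps all Ritz values
  after the first away from the shift.\<close>

lemma interlacing:
  fixes \<theta> :: real
  assumes mono: "mono_on {1..n} lam" and i: "1 \<le> i" "i + 1 \<le> n"
    and Y: "Y \<in> carrier_mat n 2"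
    and Y_zero: "\<And>c l. c \<in> carrier_vec 2 \<Longrightarrow> l < i - 1 \<Longrightarrow> (Y *\<^sub>v c) $ l = 0"
    and Y_kernel: "\<And>c. c \<in> carrier_vec 2 \<Longrightarrow> Y *\<^sub>v c = 0\<^sub>v n \<Longrightarrow> c = 0\<^sub>v 2"
    and Y_bound: "\<And>c. c \<in> carrier_vec 2 \<Longrightarrow>
      (\<Sum>l<n. lam (Suc l) * (cmod ((Y *\<^sub>v c) $ l))\<^sup>2) \<le> \<theta> * (\<Sum>l<n. (cmod ((Y *\<^sub>v c) $ l))\<^sup>2)"
  shows "lam (i + 1) \<le> \<theta>"
proof (rule ccontr)
  assume *: "\<not> lam (i + 1) \<le> \<theta>"
  define A where "A = mat 1 2 (\<lambda>(r, s). Y $$ (i - 1, s))"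
  have A: "A \<in> carrier_mat 1 2" by (simp add: A_def)
  obtain c where c: "c \<in> carrier_vec 2" "c \<noteq> 0\<^sub>v 2" "A *\<^sub>v c = 0\<^sub>v 1"
    using underdetermined_kernel[OF A] by auto
  define x where "x = Y *\<^sub>v c"
  have "(A *\<^sub>v c) $ 0 = x $ (i - 1)"
    using Y c(1) i by (simp add: A_def x_def scalar_prod_def)
  then have x0: "x $ l = 0" if "l < i" for l
    using c(3) Y_zero[OF c(1), of l] that by (cases "l = i - 1") (auto simp: x_def)
  have "lam (i + 1) * (\<Sum>l<n. (cmod (x $ l))\<^sup>2) \<le> (\<Sum>l<n. lam (Suc l) * (cmod (x $ l))\<^sup>2)"
    unfolding sum_distrib_left
  proof (rule sum_mono)
    fix l assume l: "l \<in> {..<n}"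
    have "i \<le> l \<Longrightarrow> lam (i + 1) \<le> lam (Suc l)" using l i by (intro mono_onD[OF mono]) auto
    then show "lam (i + 1) * (cmod (x $ l))\<^sup>2 \<le> lam (Suc l) * (cmod (x $ l))\<^sup>2"
      using x0[of l] by (cases "l < i") (auto intro: mult_right_mono)
  qed
  also have "\<dots> \<le> \<theta> * (\<Sum>l<n. (cmod (x $ l))\<^sup>2)" using Y_bound[OF c(1)] by (simp add: x_def)
  finally have "(\<Sum>l<n. (cmod (x $ l))\<^sup>2) \<le> 0"
    using * by (auto simp: mult_le_cancel_right)
  then have "x = 0\<^sub>v n"
    unfolding x_def by (intro sum_norm_sq_eq_0 mult_mat_vec_carrier[OF Y c(1)])
  then show False using Y_kernel[OF c(1)] c(2) by (simp add: x_def)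
qed

text \<open>Origin of the constant: with \<open>x\<close>, \<open>y\<close>, \<open>z\<close> the
  distances of \<open>lam j\<close>, \<open>lam (j + 1)\<close>, \<open>lam n\<close> from the
  shift, the factor is half the length of the interval from 1/z to 1/y, divided by the signed
  distance of 1/x from its midpoint. The assumption that 1/x is not this midpoint says that 2 -
  \<kappa> is nonzero.\<close>

lemma kappa_shift_inverse:
  fixes x y z :: real
  assumes "x \<noteq> 0" "0 < y" "0 < z" "x \<noteq> z" "1 / x \<noteq> (1 / y + 1 / z) / 2"
  defines "\<kappa> \<equiv> (x / y) * ((z - y) / (z - x))"
  shows "\<kappa> / (2 - \<kappa>) = ((1 / y - 1 / z) / 2) / (1 / x - (1 / y + 1 / z) / 2)"
proof -
  have D: "2 * y * z - x * z - x * y \<noteq> 0" using assms(1-5) by (auto simp: field_simps)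
  have "2 - \<kappa> = (2 * y * z - x * z - x * y) / (y * (z - x))"
    using assms(1-4) by (simp add: \<kappa>_def field_simps)
  then have "\<kappa> / (2 - \<kappa>) = x * (z - y) / (2 * y * z - x * z - x * y)"
    using assms(1-4) D by (simp add: \<kappa>_def divide_simps)
  moreover have "1 / x - (1 / y + 1 / z) / 2 = (2 * y * z - x * z - x * y) / (2 * x * y * z)"
    "(1 / y - 1 / z) / 2 = x * (z - y) / (2 * x * y * z)"
    using assms(1-3) by (simp_all add: field_simps)
  ultimately show ?thesis using assms(1-3) D by (simp only:) (simp add: divide_simps)
qed

text \<open>On the indices above \<open>i\<close> the values \<open>\<alpha>\<close> are positive
  and decreasing, so among those up to \<open>j\<close> the value \<open>\<alpha> j\<close> is
  nearest to the midpoint \<open>c\<close>. The index \<open>i\<close> lies on the other side of 0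
  and is compared separately.\<close>

lemma shift_invert_separation:
  fixes lam :: "nat \<Rightarrow> real"
  assumes mono: "mono_on {1..n} lam" and ij: "1 \<le> i" "i \<le> j" "j + 1 \<le> n"
    and \<sigma>: "lam i < \<sigma>" "\<sigma> < (lam i + lam (i + 1)) / 2" and gap: "lam j < lam (j + 1)"
  defines "\<kappa> \<equiv> ((lam j - \<sigma>) / (lam (j + 1) - \<sigma>)) * ((lam n - lam (j + 1)) / (lam n - lam j))"
  shows "\<exists>a b c. 0 \<le> a \<and> a \<le> b \<and> 0 < b \<and> (\<kappa> / (2 - \<kappa>))\<^sup>2 = (a / b)\<^sup>2 \<and>
    (\<forall>l \<in> {i..j}. b \<le> \<bar>1 / (lam l - \<sigma>) - c\<bar>) \<and> (\<forall>l \<in> {j + 1..n}. \<bar>1 / (lam l - \<sigma>) - c\<bar> \<le> a)"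
proof -
  define \<alpha> where "\<alpha> l = 1 / (lam l - \<sigma>)" for l
  define a where "a = (\<alpha> (j + 1) - \<alpha> n) / 2"
  define c where "c = (\<alpha> (j + 1) + \<alpha> n) / 2"
  define b where "b = \<bar>\<alpha> j - c\<bar>"
  have \<sigma>2: "\<sigma> < lam (i + 1)" using \<sigma> by simp
  have above: "lam (i + 1) \<le> lam l" if "i < l" "l \<le> n" for l
    using that ij by (intro mono_onD[OF mono]) auto
  have anti: "0 < \<alpha> l \<and> \<alpha> l \<le> \<alpha> k" if "i < k" "k \<le> l" "l \<le> n" for k l
  proof -
    have "lam k \<le> lam l" using that ij by (intro mono_onD[OF mono]) auto
    then show ?thesis using above[of k] that \<sigma>2 by (auto simp: \<alpha>_def intro!: frac_le)
  qed
  have \<alpha>n: "0 < \<alpha> n" "\<alpha> n \<le> \<alpha> (j + 1)" using anti[of "j + 1" n] ij by auto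
  then have a: "0 \<le> a" "a < c" "c \<le> \<alpha> (j + 1)" by (simp_all add: a_def c_def)
  have \<alpha>i: "\<alpha> i < 0" using \<sigma> by (simp add: \<alpha>_def)
  have \<alpha>j: "\<alpha> (j + 1) < \<alpha> j" if "i < j"
    using above[of j] that ij gap \<sigma>2 by (auto simp: \<alpha>_def intro!: divide_strict_left_mono)
  have b: "a \<le> b" "0 < b" "\<alpha> j \<noteq> c"
  proof -
    have "a \<le> b \<and> 0 < b \<and> \<alpha> j \<noteq> c"
    proof (cases "i = j")
      case True
      then show ?thesis using \<alpha>i a by (auto simp: b_def)
    next
      case False
      moreover have "\<alpha> (j + 1) - c = a" by (simp add: a_def c_def field_simps)
      ultimately show ?thesis using \<alpha>j a ij by (auto simp: b_def)
    qed
    then show "a \<le> b" "0 < b" "\<alpha> j \<noteq> c" by simp_all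
  qed
  have low: "b \<le> \<bar>\<alpha> l - c\<bar>" if l: "l \<in> {i..j}" for l
  proof (cases "i = j")
    case True
    then show ?thesis using l by (simp add: b_def)
  next
    case False
    then have j: "i < j" using ij by simp
    then have b': "b = \<alpha> j - c" using \<alpha>j a by (simp add: b_def)
    show ?thesis
    proof (cases "l = i")
      case True
      \<comment> \<open>\<open>\<sigma>\<close> lies in the left half of the gap after
        \<open>lam i\<close>, so \<open>\<sigma> - lam i\<close> is at most
        \<open>lam (i + 1) - \<sigma>\<close>, hence at most \<open>lam j - \<sigma>\<close>. As
        \<open>\<alpha> i\<close> is negative and \<open>c\<close> positive, the distance between
        them is larger still.\<close>
      have "\<alpha> j \<le> 1 / (\<sigma> - lam i)"
        unfolding \<alpha>_def using above[of j] j ij \<sigma> by (intro frac_le) auto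
      also have "\<dots> = - \<alpha> i" by (simp add: \<alpha>_def minus_divide_right)
      finally show ?thesis using True a \<alpha>i b' by simp
    next
      case False
      then have "\<alpha> j \<le> \<alpha> l" using anti[of l j] l ij by auto
      then show ?thesis using b' by simp
    qed
  qed
  have high: "\<bar>\<alpha> l - c\<bar> \<le> a" if l: "l \<in> {j + 1..n}" for l
    using anti[of l n] anti[of "j + 1" l] l ij by (auto simp: a_def c_def abs_le_iff field_simps)
  have lamn: "lam (j + 1) \<le> lam n" using ij by (intro mono_onD[OF mono]) auto
  have "lam j \<noteq> \<sigma>" using \<sigma> \<sigma>2 above[of j] ij by (cases "i = j") auto
  then have "\<kappa> / (2 - \<kappa>) = a / (\<alpha> j - c)"
    using kappa_shift_inverse[of "lam j - \<sigma>" "lam (j + 1) - \<sigma>" "lam n - \<sigma>"]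
      above[of "j + 1"] above[of n] ij \<sigma>2 gap lamn b(3)
    by (simp add: \<kappa>_def a_def c_def \<alpha>_def)
  \<comment> \<open>For \<open>i = j\<close> the denominator \<open>\<alpha> j - c\<close> is
    negative; the squares agree in either case.\<close>
  then have "(\<kappa> / (2 - \<kappa>))\<^sup>2 = (a / b)\<^sup>2"
    by (simp add: b_def power_divide)
  then show ?thesis using a(1) b(1,2) low high unfolding \<alpha>_def by blast
qed

section \<open>Ritz vectors and preconditioned residuals\<close>

lemma ritz_form:
  assumes "A \<in> carrier_mat n n" "Q \<in> carrier_mat n m" "c \<in> carrier_vec m"
    and "mat_adjoint Q * A * Q = mat_diag m (\<lambda>l. complex_of_real (d l))"
  shows "Re ((A *\<^sub>v (Q *\<^sub>v c)) \<bullet>c (Q *\<^sub>v c)) = (\<Sum>l<m. d l * (cmod (c $ l))\<^sup>2)"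
  unfolding congruence_form[OF assms(1-3,3), symmetric] assms(4) diag_form[OF assms(3)] by simp

lemma orthonormal_form:
  assumes "S \<in> carrier_mat n n" "Q \<in> carrier_mat n m" "c \<in> carrier_vec m"
    and "mat_adjoint Q * S * Q = 1\<^sub>m m"
  shows "Re ((S *\<^sub>v (Q *\<^sub>v c)) \<bullet>c (Q *\<^sub>v c)) = (\<Sum>l<m. (cmod (c $ l))\<^sup>2)"
  unfolding congruence_form[OF assms(1-3,3), symmetric] assms(4) one_mult_mat_vec[OF assms(3)]
    cscalar_self[OF assms(3)] by simp

lemma orthonormal_kernel:
  fixes c :: "complex vec"
  assumes S: "S \<in> carrier_mat n n" and Q: "Q \<in> carrier_mat n m" and c: "c \<in> carrier_vec m"
    and QSQ: "mat_adjoint Q * S * Q = 1\<^sub>m m" and Qc: "Q *\<^sub>v c = 0\<^sub>v n"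
  shows "c = 0\<^sub>v m"
proof -
  have "(\<Sum>l<m. (cmod (c $ l))\<^sup>2) = 0"
    unfolding orthonormal_form[OF S Q c QSQ, symmetric] Qc by (simp add: scalar_prod_def)
  then show ?thesis using c by (intro sum_norm_sq_eq_0) simp_all
qed

text \<open>\<open>ritz_values\<close> orders \<open>\<mu>\<close> only up to the dimension of
  \<open>X\<close>, which is existentially hidden. Monotonicity on \<open>{1..t}\<close> is how the
  fact that \<open>X\<close> has dimension at least \<open>t\<close> leaves this lemma.\<close>

lemma ritz_upper_bound:
  assumes H: "H \<in> carrier_mat n n" "hermitian H" and S: "S \<in> carrier_mat n n" "positive_definite S"
    and ritz: "ritz_values n H S X \<mu>" and t: "1 \<le> t"
    and E: "E \<in> carrier_mat n t" "\<And>q. q < t \<Longrightarrow> col E q \<in> X"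
    and E_kernel: "\<And>c. c \<in> carrier_vec t \<Longrightarrow> E *\<^sub>v c = 0\<^sub>v n \<Longrightarrow> c = 0\<^sub>v t"
    and bound: "\<And>c. c \<in> carrier_vec t \<Longrightarrow>
      Re ((H *\<^sub>v (E *\<^sub>v c)) \<bullet>c (E *\<^sub>v c)) \<le> M * Re ((S *\<^sub>v (E *\<^sub>v c)) \<bullet>c (E *\<^sub>v c))"
  shows "mono_on {1..t} \<mu> \<and> \<mu> t \<le> M"
proof -
  obtain m Q where Q: "Q \<in> carrier_mat n m" and QS: "mat_adjoint Q * S * Q = 1\<^sub>m m"
    and QH: "mat_adjoint Q * H * Q = mat_diag m (\<lambda>l. complex_of_real (\<mu> (Suc l)))"
    and X: "X = {Q *\<^sub>v c | c. c \<in> carrier_vec m}" and mono: "mono_on {1..m} \<mu>"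
    using ritz_values_diagonalization[OF H S ritz] by blast
  obtain Y where Y: "Y \<in> carrier_mat m t" and EQY: "E = Q * Y"
    using factor_through_range[OF Q E(1)] E(2) unfolding X by blast
  have Ec: "E *\<^sub>v c = Q *\<^sub>v (Y *\<^sub>v c)" "Y *\<^sub>v c \<in> carrier_vec m" if "c \<in> carrier_vec t" for c
    using that Q Y mult_mat_vec_carrier[OF Y that] by (auto simp: EQY assoc_dim)
  have "t \<le> m \<and> \<mu> t \<le> M"
  proof (rule courant_fischer_coordinates[OF Y t mono])
    fix c :: "complex vec" assume c: "c \<in> carrier_vec t"
    show "c = 0\<^sub>v t" if "Y *\<^sub>v c = 0\<^sub>v m"
    proof (rule E_kernel[OF c])
      show "E *\<^sub>v c = 0\<^sub>v n" unfolding Ec(1)[OF c] that using Q by auto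
    qed
    show "(\<Sum>l<m. \<mu> (Suc l) * (cmod ((Y *\<^sub>v c) $ l))\<^sup>2) \<le> M * (\<Sum>l<m. (cmod ((Y *\<^sub>v c) $ l))\<^sup>2)"
      using bound[OF c]
      unfolding Ec(1)[OF c] ritz_form[OF H(1) Q Ec(2)[OF c] QH] orthonormal_form[OF S(1) Q Ec(2)[OF c] QS] .
  qed
  then show ?thesis using mono_on_subset[OF mono, of "{1..t}"] by auto
qed

text \<open>Here \<open>Z\<close> is the new iterate and \<open>X\<close> the trial space. The
  columns of \<open>Z\<close> that carry \<open>\<mu> (d + 1)\<close> to
  \<open>\<mu> (d + t)\<close> span a subspace with Rayleigh quotients at most the last of these,
  and Courant-Fischer is applied inside the span of \<open>Z\<close>.\<close>

lemma new_ritz_value_bound: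
  assumes H: "H \<in> carrier_mat n n" "hermitian H" and S: "S \<in> carrier_mat n n" "positive_definite S"
    and Z: "Z \<in> carrier_mat n k" "mat_adjoint Z * S * Z = 1\<^sub>m k"
    and p: "p permutes {1..k}"
    and pairs: "\<And>l. l \<in> {1..k} \<Longrightarrow> ritz_pair n H S X (\<mu> (d + p l)) (col Z (l - 1))"
    and ritz: "ritz_values n H S (cspan n (set (cols Z))) \<theta>"
    and t: "1 \<le> t" "t \<le> k" and mono: "mono_on {1..d + t} \<mu>"
  shows "\<theta> t \<le> \<mu> (d + t)"
proof -
  \<comment> \<open>The zero-based column of \<open>Z\<close> that carries
    \<open>\<mu> (d + Suc s)\<close>, found by undoing the permutation.\<close>
  define f where "f s = inv_into UNIV p (Suc s) - 1" for s
  have f: "Suc (f s) \<in> {1..k}" "f s < k" "p (Suc (f s)) = Suc s" if "s < t" for s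
  proof -
    have "inv_into UNIV p (Suc s) \<in> {1..k}"
      using permutes_in_image[OF permutes_inv[OF p], of "Suc s"] that t by auto
    then show "Suc (f s) \<in> {1..k}" "f s < k" "p (Suc (f s)) = Suc s"
      using permutes_inverses(1)[OF p] by (auto simp: f_def)
  qed
  define Y where "Y = mat n t (\<lambda>(r, s). Z $$ (r, f s))"
  have Y: "Y \<in> carrier_mat n t" by (simp add: Y_def)
  have col: "col Y s = col Z (f s)" if "s < t" for s
    using that f(2)[OF that] Z(1) by (intro eq_vecI) (auto simp: Y_def)
  have f_inj: "f r = f s \<longleftrightarrow> r = s" if "r < t" "s < t" for r s
    using f(3)[OF that(1)] f(3)[OF that(2)] by (metis nat.inject)
  have pair: "ritz_pair n H S X (\<mu> (d + Suc s)) (col Y s)" if "s < t" for s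
    using pairs[OF f(1)[OF that]] f(3)[OF that] by (simp add: col that)
  have YX: "col Y s \<in> X" if "s < t" for s
    by (rule ritz_pair_mem[OF pair[OF that]])
  have YS: "mat_adjoint Y * S * Y = 1\<^sub>m t"
  proof (rule eq_matI)
    fix r s assume "r < dim_row (1\<^sub>m t :: complex mat)" "s < dim_col (1\<^sub>m t :: complex mat)"
    then have rs: "r < t" "s < t" by auto
    have "(mat_adjoint Y * S * Y) $$ (r, s) = (mat_adjoint Z * S * Z) $$ (f r, f s)"
      using index_congruence[OF S(1) Y rs] index_congruence[OF S(1) Z(1) f(2)[OF rs(1)] f(2)[OF rs(2)]]
      by (simp add: col rs)
    then show "(mat_adjoint Y * S * Y) $$ (r, s) = 1\<^sub>m t $$ (r, s)"
      using rs f(2) f_inj by (simp add: Z(2))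
  qed (use Y in auto)
  \<comment> \<open>The Galerkin condition makes each entry a multiple of the one for
    \<open>S\<close>, so the \<open>S\<close>-orthonormality in \<open>YS\<close> removes the
    off-diagonal part even for repeated Ritz values.\<close>
  have YH: "mat_adjoint Y * H * Y = mat_diag t (\<lambda>s. complex_of_real (\<mu> (d + Suc s)))"
  proof (rule eq_matI)
    fix r s assume "r < dim_row (mat_diag t (\<lambda>s. complex_of_real (\<mu> (d + Suc s))))"
      "s < dim_col (mat_diag t (\<lambda>s. complex_of_real (\<mu> (d + Suc s))))"
    then have rs: "r < t" "s < t" by (auto simp: mat_diag_def)
    have "(mat_adjoint Y * H * Y) $$ (r, s) = complex_of_real (\<mu> (d + Suc s)) * (mat_adjoint Y * S * Y) $$ (r, s)"
      unfolding index_congruence[OF S(1) Y rs] index_congruence[OF H(1) Y rs]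
      by (rule ritz_pair_form[OF H(1) S(1) pair[OF rs(2)] YX[OF rs(1)]])
    then show "(mat_adjoint Y * H * Y) $$ (r, s) = mat_diag t (\<lambda>s. complex_of_real (\<mu> (d + Suc s))) $$ (r, s)"
      using rs by (auto simp: YS mat_diag_def)
  qed (use Y in \<open>auto simp: mat_diag_def\<close>)
  have "mono_on {1..t} \<theta> \<and> \<theta> t \<le> \<mu> (d + t)"
  proof (rule ritz_upper_bound[OF H S ritz t(1) Y])
    fix s assume s: "s < t"
    have "col Z (f s) \<in> set (cols Z)" using f(2)[OF s] Z(1) by (auto simp: cols_def)
    then show "col Y s \<in> cspan n (set (cols Z))"
      using col[OF s] Z(1) cols_dim[of Z]
      by (metis carrier_matD(1) module.in_own_span vec_module vec_space.cV subsetD)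
  next
    fix c :: "complex vec" assume c: "c \<in> carrier_vec t"
    show "c = 0\<^sub>v t" if "Y *\<^sub>v c = 0\<^sub>v n" by (rule orthonormal_kernel[OF S(1) Y c YS that])
    show "Re ((H *\<^sub>v (Y *\<^sub>v c)) \<bullet>c (Y *\<^sub>v c)) \<le> \<mu> (d + t) * Re ((S *\<^sub>v (Y *\<^sub>v c)) \<bullet>c (Y *\<^sub>v c))"
      unfolding ritz_form[OF H(1) Y c YH] orthonormal_form[OF S(1) Y c YS] sum_distrib_left
      using t by (intro sum_mono mult_right_mono mono_onD[OF mono]) auto
  qed
  then show ?thesis by simp
qed

lemma col_mult_unit:
  fixes A :: "complex mat"
  assumes "A \<in> carrier_mat n m" "q < m"
  shows "A *\<^sub>v unit_vec m q = col A q"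
  using assms by (intro eq_vecI) auto

text \<open>The sorted Ritz basis \<open>Q\<close> and \<open>Z\<close> have the same range, so
  dimension counts in both directions give \<open>m = k\<close> and \<open>Q = Z * N\<close>. Both
  being \<open>S\<close>-orthonormal, \<open>N\<close> is unitary, and a diagonal form of
  \<open>H\<close> on \<open>Q\<close> becomes an eigenvalue equation for the columns of
  \<open>N\<close>. This carries the residual of \<open>Z\<close> over to single Ritz
  vectors.\<close>

lemma ritz_rotation:
  assumes H: "H \<in> carrier_mat n n" "hermitian H" and S: "S \<in> carrier_mat n n" "positive_definite S"
    and Z: "Z \<in> carrier_mat n k" "mat_adjoint Z * S * Z = 1\<^sub>m k"
    and ritz: "ritz_values n H S (cspan n (set (cols Z))) \<theta>"
  shows "\<exists>N \<in> carrier_mat k k. mat_adjoint (Z * N) * S * (Z * N) = 1\<^sub>m k \<and>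
    mat_adjoint (Z * N) * H * (Z * N) = mat_diag k (\<lambda>l. complex_of_real (\<theta> (Suc l))) \<and>
    (\<forall>s<k. (mat_adjoint Z * H * Z) *\<^sub>v col N s = complex_of_real (\<theta> (Suc s)) \<cdot>\<^sub>v col N s) \<and>
    mono_on {1..k} \<theta>"
proof -
  obtain m Q where Q: "Q \<in> carrier_mat n m" and QS: "mat_adjoint Q * S * Q = 1\<^sub>m m"
    and QH: "mat_adjoint Q * H * Q = mat_diag m (\<lambda>l. complex_of_real (\<theta> (Suc l)))"
    and X: "cspan n (set (cols Z)) = {Q *\<^sub>v c | c. c \<in> carrier_vec m}" and mono: "mono_on {1..m} \<theta>"
    using ritz_values_diagonalization[OF H S ritz] by blast
  have X': "{Z *\<^sub>v c | c. c \<in> carrier_vec k} = {Q *\<^sub>v c | c. c \<in> carrier_vec m}"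
    using X cspan_cols[OF Z(1)] by simp
  have colX: "col A q \<in> {A *\<^sub>v c | c. c \<in> carrier_vec r}" if "A \<in> carrier_mat n r" "q < r"
    for A :: "complex mat" and q r
    using col_mult_unit[OF that] unit_vec_carrier by (metis (mono_tags, lifting) mem_Collect_eq)
  obtain A where A: "A \<in> carrier_mat m k" and ZQA: "Z = Q * A"
    using factor_through_range[OF Q Z(1)] colX[OF Z(1)] unfolding X' by blast
  obtain N where N: "N \<in> carrier_mat k m" and QZN: "Q = Z * N"
    using factor_through_range[OF Z(1) Q] colX[OF Q] unfolding X'[symmetric] by blast
  have "k \<le> m"
  proof (rule ccontr)
    assume "\<not> k \<le> m"
    then obtain c where c: "c \<in> carrier_vec k" "c \<noteq> 0\<^sub>v k" "A *\<^sub>v c = 0\<^sub>v m"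
      using underdetermined_kernel[OF A] by auto
    have "Z *\<^sub>v c = Q *\<^sub>v (A *\<^sub>v c)" using c Q A by (subst ZQA) (simp add: assoc_dim)
    also have "\<dots> = 0\<^sub>v n" using Q by (auto simp: c(3))
    finally show False using orthonormal_kernel[OF S(1) Z(1) c(1) Z(2)] c(2) by simp
  qed
  moreover have "m \<le> k"
  proof (rule ccontr)
    assume "\<not> m \<le> k"
    then obtain c where c: "c \<in> carrier_vec m" "c \<noteq> 0\<^sub>v m" "N *\<^sub>v c = 0\<^sub>v k"
      using underdetermined_kernel[OF N] by auto
    have "Q *\<^sub>v c = Z *\<^sub>v (N *\<^sub>v c)" using c Z N by (subst QZN) (simp add: assoc_dim)
    also have "\<dots> = 0\<^sub>v n" using Z by (auto simp: c(3))
    finally show False using orthonormal_kernel[OF S(1) Q c(1) QS] c(2) by simp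
  qed
  ultimately have m: "m = k" by simp
  note N = N[unfolded m] and QS = QS[unfolded m] and QH = QH[unfolded m]
  have eq: "mat_adjoint Q * C * Q = mat_adjoint N * (mat_adjoint Z * C * Z * N)"
    if "C \<in> carrier_mat n n" for C
    unfolding QZN using that Z N by (simp add: mat_adjoint_mult assoc_dim del: assoc_mult_mat)
  have "mat_adjoint N * N = 1\<^sub>m k"
    using eq[OF S(1)] unfolding QS Z(2) left_mult_one_mat[OF N] by (rule sym)
  then have NN: "N * mat_adjoint N = 1\<^sub>m k"
    by (rule mat_mult_left_right_inverse[OF mat_adjoint_carrier[OF N] N])
  define B where "B = mat_adjoint Z * H * Z"
  have B: "B \<in> carrier_mat k k" unfolding B_def by (intro carrier_matI) (use Z in simp_all)
  have BN: "B * N \<in> carrier_mat k k" using B N by simp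
  have "B * N = N * mat_adjoint N * (B * N)" unfolding NN by (rule left_mult_one_mat[OF BN, symmetric])
  also have "\<dots> = N * mat_diag k (\<lambda>l. complex_of_real (\<theta> (Suc l)))"
    unfolding QH[symmetric] eq[OF H(1)] B_def[symmetric] using N B
    by (intro assoc_mult_mat_dim) simp_all
  finally have BND: "B * N = N * mat_diag k (\<lambda>l. complex_of_real (\<theta> (Suc l)))" .
  have "B *\<^sub>v col N s = complex_of_real (\<theta> (Suc s)) \<cdot>\<^sub>v col N s" if "s < k" for s
  proof -
    have "B *\<^sub>v col N s = col (B * N) s" using col_mult2[OF B N that] by simp
    also have "\<dots> = complex_of_real (\<theta> (Suc s)) \<cdot>\<^sub>v col N s"
      unfolding BND mat_diag_mult_right[OF N] using N that by (intro eq_vecI) auto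
    finally show ?thesis .
  qed
  then show ?thesis using N QS QH mono unfolding QZN B_def m by blast
qed

section \<open>The pencil, the residual and the Ritz vectors in eigenvector coordinates\<close>

lemma smult_mult_vec:
  fixes A :: "complex mat"
  assumes "dim_vec v = dim_col A"
  shows "(k \<cdot>\<^sub>m A) *\<^sub>v v = k \<cdot>\<^sub>v (A *\<^sub>v v)"
  using assms by (intro eq_vecI) (auto simp: scalar_prod_def sum_distrib_left mult.assoc intro!: sum.cong)

lemma eigenbasis_pencil:
  assumes H: "H \<in> carrier_mat n n" and S: "S \<in> carrier_mat n n" and F: "F \<in> carrier_mat n n"
    and eig: "\<And>l. l < n \<Longrightarrow> H *\<^sub>v col F l = complex_of_real (lam (Suc l)) \<cdot>\<^sub>v (S *\<^sub>v col F l)"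
    and x: "x \<in> carrier_vec n"
  shows "H *\<^sub>v (F *\<^sub>v x) - complex_of_real \<tau> \<cdot>\<^sub>v (S *\<^sub>v (F *\<^sub>v x))
    = S *\<^sub>v (F *\<^sub>v vec n (\<lambda>l. complex_of_real (lam (Suc l) - \<tau>) * x $ l))"
proof -
  have HF: "H * F = S * F * mat_diag n (\<lambda>l. complex_of_real (lam (Suc l)))"
  proof (rule eq_matI)
    fix r l assume rl: "r < dim_row (S * F * mat_diag n (\<lambda>l. complex_of_real (lam (Suc l))))"
      "l < dim_col (S * F * mat_diag n (\<lambda>l. complex_of_real (lam (Suc l))))"
    then have rl: "r < n" "l < n" using S by (auto simp: mat_diag_def)
    have "(H * F) $$ (r, l) = (H *\<^sub>v col F l) $ r" using H F rl by simp
    also have "\<dots> = (S * F * mat_diag n (\<lambda>l. complex_of_real (lam (Suc l)))) $$ (r, l)"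
      using mat_diag_mult_right[of "S * F" n n] S F rl unfolding eig[OF rl(2)] by (simp del: assoc_mult_mat)
    finally show "(H * F) $$ (r, l) = (S * F * mat_diag n (\<lambda>l. complex_of_real (lam (Suc l)))) $$ (r, l)" .
  qed (use H S F in \<open>auto simp: mat_diag_def\<close>)
  define D where "D = mat_diag n (\<lambda>l. complex_of_real (lam (Suc l)))"
  have D: "D \<in> carrier_mat n n" by (simp add: D_def)
  have Dx: "D *\<^sub>v x \<in> carrier_vec n" "F *\<^sub>v x \<in> carrier_vec n" "F *\<^sub>v (D *\<^sub>v x) \<in> carrier_vec n"
    using D F x by auto
  have "H *\<^sub>v (F *\<^sub>v x) = (H * F) *\<^sub>v x" using H F x by (simp add: assoc_dim)
  also have "\<dots> = S *\<^sub>v (F *\<^sub>v (D *\<^sub>v x))"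
    unfolding HF D_def[symmetric] using S F D x by (simp add: assoc_dim del: assoc_mult_mat assoc_mult_mat_vec)
  finally have "H *\<^sub>v (F *\<^sub>v x) - complex_of_real \<tau> \<cdot>\<^sub>v (S *\<^sub>v (F *\<^sub>v x))
      = S *\<^sub>v (F *\<^sub>v (D *\<^sub>v x)) - S *\<^sub>v (F *\<^sub>v (complex_of_real \<tau> \<cdot>\<^sub>v x))"
    using S F x Dx by (simp add: mult_smult_vec)
  also have "\<dots> = S *\<^sub>v (F *\<^sub>v (D *\<^sub>v x - complex_of_real \<tau> \<cdot>\<^sub>v x))"
    using S F x Dx by (simp add: mult_minus_distrib_mat_vec[of _ n n])
  also have "D *\<^sub>v x - complex_of_real \<tau> \<cdot>\<^sub>v x = vec n (\<lambda>l. complex_of_real (lam (Suc l) - \<tau>) * x $ l)"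
    unfolding D_def using x by (intro eq_vecI) (auto simp: mult_diag_vec left_diff_distrib simp del: index_mult_mat_vec)
  finally show ?thesis .
qed

text \<open>Dividing the coordinates of the residual by \<open>lam (Suc l) - \<sigma>\<close>
  exhibits it as the image of some \<open>F *\<^sub>v y\<close> under the shifted matrix, which
  \<open>K\<close> then cancels.\<close>

lemma preconditioned_residual:
  assumes H: "H \<in> carrier_mat n n" and S: "S \<in> carrier_mat n n" and F: "F \<in> carrier_mat n n"
    and eig: "\<And>l. l < n \<Longrightarrow> H *\<^sub>v col F l = complex_of_real (lam (Suc l)) \<cdot>\<^sub>v (S *\<^sub>v col F l)"
    and K: "K \<in> carrier_mat n n" "inverts_mat K (H - complex_of_real \<sigma> \<cdot>\<^sub>m S)"
    and \<sigma>: "\<And>l. l < n \<Longrightarrow> lam (Suc l) \<noteq> \<sigma>" and x: "x \<in> carrier_vec n"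
  shows "K *\<^sub>v (H *\<^sub>v (F *\<^sub>v x) - complex_of_real \<tau> \<cdot>\<^sub>v (S *\<^sub>v (F *\<^sub>v x)))
    = F *\<^sub>v vec n (\<lambda>l. complex_of_real ((lam (Suc l) - \<tau>) / (lam (Suc l) - \<sigma>)) * x $ l)"
proof -
  define y where "y = vec n (\<lambda>l. complex_of_real ((lam (Suc l) - \<tau>) / (lam (Suc l) - \<sigma>)) * x $ l)"
  have y: "y \<in> carrier_vec n" "F *\<^sub>v y \<in> carrier_vec n" using F by (auto simp: y_def)
  have "vec n (\<lambda>l. complex_of_real (lam (Suc l) - \<tau>) * x $ l)
      = vec n (\<lambda>l. complex_of_real (lam (Suc l) - \<sigma>) * y $ l)" (is "?v = ?w")
  proof (rule eq_vecI)
    fix l assume "l < dim_vec ?w"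
    then have l: "l < n" by simp
    have "(lam (Suc l) - \<sigma>) * ((lam (Suc l) - \<tau>) / (lam (Suc l) - \<sigma>)) = lam (Suc l) - \<tau>"
      using \<sigma>[OF l] by simp
    then have "complex_of_real (lam (Suc l) - \<sigma>) * complex_of_real ((lam (Suc l) - \<tau>) / (lam (Suc l) - \<sigma>))
        = complex_of_real (lam (Suc l) - \<tau>)"
      unfolding of_real_mult[symmetric] by (rule arg_cong)
    then have "complex_of_real (lam (Suc l) - \<sigma>) * (complex_of_real ((lam (Suc l) - \<tau>) / (lam (Suc l) - \<sigma>)) * x $ l)
        = complex_of_real (lam (Suc l) - \<tau>) * x $ l"
      unfolding mult.assoc[symmetric] by (rule arg_cong)
    then show "?v $ l = ?w $ l" using l unfolding y_def by (simp only: index_vec)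
  qed simp
  moreover have "H *\<^sub>v (F *\<^sub>v x) - complex_of_real \<tau> \<cdot>\<^sub>v (S *\<^sub>v (F *\<^sub>v x)) = S *\<^sub>v (F *\<^sub>v ?v)"
    by (rule eigenbasis_pencil[OF H S F eig x])
  ultimately have "H *\<^sub>v (F *\<^sub>v x) - complex_of_real \<tau> \<cdot>\<^sub>v (S *\<^sub>v (F *\<^sub>v x)) = S *\<^sub>v (F *\<^sub>v ?w)"
    by (simp only:)
  also have "\<dots> = H *\<^sub>v (F *\<^sub>v y) - complex_of_real \<sigma> \<cdot>\<^sub>v (S *\<^sub>v (F *\<^sub>v y))"
    by (rule eigenbasis_pencil[OF H S F eig y(1), symmetric])
  also have "\<dots> = (H - complex_of_real \<sigma> \<cdot>\<^sub>m S) *\<^sub>v (F *\<^sub>v y)"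
  proof -
    have "(complex_of_real \<sigma> \<cdot>\<^sub>m S) *\<^sub>v (F *\<^sub>v y) = complex_of_real \<sigma> \<cdot>\<^sub>v (S *\<^sub>v (F *\<^sub>v y))"
      using S F y by (intro smult_mult_vec) simp
    then show ?thesis
      using minus_mult_distrib_mat_vec[OF H smult_carrier_mat[OF S] y(2), of "complex_of_real \<sigma>"] by simp
  qed
  finally have "K *\<^sub>v (H *\<^sub>v (F *\<^sub>v x) - complex_of_real \<tau> \<cdot>\<^sub>v (S *\<^sub>v (F *\<^sub>v x)))
      = (K * (H - complex_of_real \<sigma> \<cdot>\<^sub>m S)) *\<^sub>v (F *\<^sub>v y)"
    using K H S F y by (simp add: assoc_dim)
  also have "\<dots> = F *\<^sub>v y"
    using K y unfolding inverts_mat_def by simp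
  finally show ?thesis by (simp add: y_def)
qed

text \<open>\<open>mat_adjoint F * S\<close> inverts the eigenvector matrix \<open>F\<close>, so
  \<open>Y\<close> consists of the coordinates of the first \<open>t\<close> sorted Ritz vectors.
  Their combinations involve only Ritz values up to \<open>\<theta> t\<close>, whence the Rayleigh
  bound.\<close>

lemma ritz_coordinates:
  assumes H: "H \<in> carrier_mat n n" and S: "S \<in> carrier_mat n n" and F: "F \<in> carrier_mat n n"
    and FS: "mat_adjoint F * S * F = 1\<^sub>m n"
    and FH: "mat_adjoint F * H * F = mat_diag n (\<lambda>l. complex_of_real (lam (Suc l)))"
    and Q: "Q \<in> carrier_mat n k" and QS: "mat_adjoint Q * S * Q = 1\<^sub>m k"
    and QH: "mat_adjoint Q * H * Q = mat_diag k (\<lambda>l. complex_of_real (\<theta> (Suc l)))"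
    and mono: "mono_on {1..k} \<theta>" and t: "1 \<le> t" "t \<le> k"
  defines "Y \<equiv> mat n t (\<lambda>(r, s). (mat_adjoint F * S * Q) $$ (r, s))"
  shows "\<And>s. s < t \<Longrightarrow> F *\<^sub>v col Y s = col Q s"
    and "\<And>c. c \<in> carrier_vec t \<Longrightarrow> Y *\<^sub>v c = 0\<^sub>v n \<Longrightarrow> c = 0\<^sub>v t"
    and "\<And>c. c \<in> carrier_vec t \<Longrightarrow>
      (\<Sum>l<n. lam (Suc l) * (cmod ((Y *\<^sub>v c) $ l))\<^sup>2) \<le> \<theta> t * (\<Sum>l<n. (cmod ((Y *\<^sub>v c) $ l))\<^sup>2)"
proof -
  define G where "G = mat_adjoint F * S"
  have G: "G \<in> carrier_mat n n" unfolding G_def using F S by (intro carrier_matI) simp_all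
  have FG: "F * G = 1\<^sub>m n" by (rule mat_mult_left_right_inverse[OF G F FS[folded G_def]])
  have Y: "Y \<in> carrier_mat n t" by (simp add: Y_def)
  show col: "F *\<^sub>v col Y s = col Q s" if "s < t" for s
  proof -
    have "s < k" using that t by simp
    have "col Y s = col (G * Q) s"
      using that \<open>s < k\<close> G Q by (intro eq_vecI) (simp_all add: Y_def G_def[symmetric])
    also have "\<dots> = G *\<^sub>v col Q s" by (rule col_mult2[OF G Q \<open>s < k\<close>])
    finally have "F *\<^sub>v col Y s = F * G *\<^sub>v col Q s"
      using F G Q by (simp add: assoc_mult_mat_vec_dim)
    moreover have "col Q s \<in> carrier_vec n" using Q by (intro carrier_vecI) simp
    ultimately show ?thesis by (simp add: FG)
  qed
  define R where "R = mat n t (\<lambda>(r, s). Q $$ (r, s))"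
  have R: "R \<in> carrier_mat n t" by (simp add: R_def)
  have colR: "col R s = col Q s" if "s < t" for s
    using that t Q by (intro eq_vecI) (simp_all add: R_def)
  have "R = F * Y"
  proof (rule eq_matI)
    fix r s assume "r < dim_row (F * Y)" "s < dim_col (F * Y)"
    then have rs: "r < n" "s < t" using F Y by auto
    have "(F * Y) $$ (r, s) = (F *\<^sub>v col Y s) $ r" using F Y rs by simp
    then show "R $$ (r, s) = (F * Y) $$ (r, s)" unfolding col[OF rs(2)] using rs Q t by (simp add: R_def)
  qed (use F Y R in auto)
  then have Rc: "R *\<^sub>v c = F *\<^sub>v (Y *\<^sub>v c)" if "c \<in> carrier_vec t" for c
    using F Y that by (simp add: assoc_mult_mat_vec_dim)
  have ent: "(mat_adjoint R * A * R) $$ (r, s) = (mat_adjoint Q * A * Q) $$ (r, s)"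
    if "A \<in> carrier_mat n n" "r < t" "s < t" for A r s
  proof -
    have "r < k" "s < k" using that t by auto
    then show ?thesis
      unfolding index_congruence[OF that(1) R that(2,3)] index_congruence[OF that(1) Q \<open>r < k\<close> \<open>s < k\<close>]
        colR[OF that(2)] colR[OF that(3)] by simp
  qed
  have RS: "mat_adjoint R * S * R = 1\<^sub>m t"
    by (rule eq_matI) (use R t in \<open>simp_all add: ent[OF S] QS del: index_mult_mat(1) assoc_mult_mat\<close>)
  have RH: "mat_adjoint R * H * R = mat_diag t (\<lambda>l. complex_of_real (\<theta> (Suc l)))"
    by (rule eq_matI) (use R t in \<open>simp_all add: ent[OF H] QH mat_diag_def del: index_mult_mat(1) assoc_mult_mat\<close>)
  show "c = 0\<^sub>v t" if c: "c \<in> carrier_vec t" "Y *\<^sub>v c = 0\<^sub>v n" for c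
  proof (rule orthonormal_kernel[OF S R c(1) RS])
    show "R *\<^sub>v c = 0\<^sub>v n" unfolding Rc[OF c(1)] c(2) using F by auto
  qed
  show "(\<Sum>l<n. lam (Suc l) * (cmod ((Y *\<^sub>v c) $ l))\<^sup>2) \<le> \<theta> t * (\<Sum>l<n. (cmod ((Y *\<^sub>v c) $ l))\<^sup>2)"
    if c: "c \<in> carrier_vec t" for c
  proof -
    have x: "Y *\<^sub>v c \<in> carrier_vec n" by (rule mult_mat_vec_carrier[OF Y c])
    have "(\<Sum>l<t. \<theta> (Suc l) * (cmod (c $ l))\<^sup>2) \<le> \<theta> t * (\<Sum>l<t. (cmod (c $ l))\<^sup>2)"
      unfolding sum_distrib_left
      using t by (intro sum_mono mult_right_mono mono_onD[OF mono]) auto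
    then show ?thesis
      unfolding ritz_form[OF H F x FH, symmetric] orthonormal_form[OF S F x FS, symmetric]
        ritz_form[OF H R c RH, symmetric] orthonormal_form[OF S R c RS, symmetric] Rc[OF c] .
  qed
qed

section \<open>Membership in the trial space and one step of the iteration\<close>

lemma cspan_lincomb:
  assumes A: "finite A" "A \<subseteq> carrier_vec n" and xy: "x \<in> cspan n A" "y \<in> cspan n A"
  shows "a \<cdot>\<^sub>v x + b \<cdot>\<^sub>v y \<in> cspan n A"
proof -
  obtain xs where xs: "set xs = A" using finite_list[OF A(1)] by blast
  define M where "M = mat_of_cols n xs"
  have M: "M \<in> carrier_mat n (length xs)" by (simp add: M_def)
  have "cols M = xs" unfolding M_def using A(2) xs by (intro cols_mat_of_cols) auto
  then have X: "cspan n A = {M *\<^sub>v c | c. c \<in> carrier_vec (length xs)}"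
    using cspan_cols[OF M] xs by simp
  obtain c d where c: "c \<in> carrier_vec (length xs)" "x = M *\<^sub>v c"
    and d: "d \<in> carrier_vec (length xs)" "y = M *\<^sub>v d"
    using xy unfolding X by blast
  have "a \<cdot>\<^sub>v x + b \<cdot>\<^sub>v y = M *\<^sub>v (a \<cdot>\<^sub>v c + b \<cdot>\<^sub>v d)"
    using mult_add_distrib_mat_vec[OF M smult_carrier_vec[THEN iffD2, OF c(1)] smult_carrier_vec[THEN iffD2, OF d(1)]] M c d
    by (simp add: mult_smult_vec)
  moreover have "a \<cdot>\<^sub>v c + b \<cdot>\<^sub>v d \<in> carrier_vec (length xs)" using c d by simp
  ultimately show ?thesis unfolding X by blast
qed

lemma cspan_mono_cols:
  assumes "A \<in> carrier_mat n m" "set (cols A) \<subseteq> B" "c \<in> carrier_vec m"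
  shows "A *\<^sub>v c \<in> cspan n B"
proof -
  interpret vec_space "TYPE(complex)" n .
  have "A *\<^sub>v c \<in> cspan n (set (cols A))" using cspan_cols[OF assms(1)] assms(3) by auto
  then show ?thesis using span_is_monotone[OF assms(2)] by auto
qed

text \<open>Both claims are instances: \<open>t = 1\<close> gives \<open>j = i\<close>, and larger
  \<open>t\<close> the remaining Ritz values.\<close>

lemma bpsd_id_ritz_value_step:
  fixes n i j k t :: nat
    and H S K U V Z Z' :: "complex mat"
    and lam \<theta> \<theta>' :: "nat \<Rightarrow> real"
    and u :: "nat \<Rightarrow> complex vec"
    and \<sigma> :: real
  assumes H: "H \<in> carrier_mat n n" "hermitian H"
    and S: "S \<in> carrier_mat n n" "positive_definite S"
    and lam: "pair_eigenvalues H S lam"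
    and i: "1 \<le> i"
    and u: "S_orthonormal_eigenbasis n H S lam u"
    and U: "U = mat_of_cols n (map u [1..<i])"
    and V: "V = mat_of_cols n (map u [i..<Suc n])"
    and \<sigma>: "lam i < \<sigma>" "\<sigma> < (lam i + lam (i + 1)) / 2"
    and K: "K \<in> carrier_mat n n" "inverts_mat K (H - complex_of_real \<sigma> \<cdot>\<^sub>m S)"
    and iterate: "bpsd_id_iterate n H S (cspan n (set (cols V))) k Z"
    and step: "bpsd_id_step n H S K U Z Z'"
    and ritz: "ritz_values n H S (cspan n (set (cols Z))) \<theta>"
    and ritz': "ritz_values n H S (cspan n (set (cols Z'))) \<theta>'"
    and t: "1 \<le> t" "t \<le> k" and j: "j = i - 1 + t" "j + 1 \<le> n"
    and \<theta>1: "\<theta> 1 \<noteq> \<sigma>" and \<theta>t: "lam j < \<theta> t" "\<theta> t < lam (j + 1)"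
  defines "\<kappa> \<equiv> ((lam j - \<sigma>) / (lam (j + 1) - \<sigma>)) * ((lam n - lam (j + 1)) / (lam n - lam j))"
  shows "(\<theta>' t - lam j) / (lam (j + 1) - \<theta>' t)
    \<le> (\<kappa> / (2 - \<kappa>))\<^sup>2 * ((\<theta> t - lam j) / (lam (j + 1) - \<theta> t))"
proof -
  have ij: "i \<le> j" using i t(1) j(1) by linarith
  have in1: "i + 1 \<le> n" using ij j(2) by linarith
  have mono: "mono_on {1..n} lam" using lam H by (simp add: pair_eigenvalues_def)

  define F where "F = mat_of_cols n (map u [1..<Suc n])"
  have F: "F \<in> carrier_mat n n" by (intro carrier_matI) (simp_all add: F_def)
  have pair: "pair_eigenvector H S (lam l) (u l)" if "l \<in> {1..n}" for l
    using u that by (simp add: S_orthonormal_eigenbasis_def)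
  have uc: "u l \<in> carrier_vec n" if "l \<in> {1..n}" for l
    using pair[OF that] H(1) by (simp add: pair_eigenvector_def)
  have colF: "col F l = u (Suc l)" if "l < n" for l
    using that uc[of "Suc l"] by (simp add: F_def del: upt_Suc)
  have eig: "H *\<^sub>v col F l = complex_of_real (lam (Suc l)) \<cdot>\<^sub>v (S *\<^sub>v col F l)" if "l < n" for l
    using pair[of "Suc l"] that by (simp add: colF pair_eigenvector_def)
  have FS: "mat_adjoint F * S * F = 1\<^sub>m n"
    using u F unfolding S_orthonormal_eigenbasis_def S_orthonormal_def F_def[symmetric] by simp
  have FH: "mat_adjoint F * H * F = mat_diag n (\<lambda>l. complex_of_real (lam (Suc l)))"
  proof (rule eq_matI)
    fix r l assume "r < dim_row (mat_diag n (\<lambda>l. complex_of_real (lam (Suc l))))"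
      "l < dim_col (mat_diag n (\<lambda>l. complex_of_real (lam (Suc l))))"
    then have rl: "r < n" "l < n" by (auto simp: mat_diag_def)
    have "(mat_adjoint F * H * F) $$ (r, l) = complex_of_real (lam (Suc l)) * (mat_adjoint F * S * F) $$ (r, l)"
      unfolding index_congruence[OF H(1) F rl] index_congruence[OF S(1) F rl] eig[OF rl(2)]
      using S(1) F by (intro cscalar_smult) simp
    then show "(mat_adjoint F * H * F) $$ (r, l) = mat_diag n (\<lambda>l. complex_of_real (lam (Suc l))) $$ (r, l)"
      using rl by (auto simp: FS mat_diag_def)
  qed (use F in \<open>auto simp: mat_diag_def\<close>)

  have Z: "Z \<in> carrier_mat n k" "mat_adjoint Z * S * Z = 1\<^sub>m k"
    and ZV: "set (cols Z) \<subseteq> cspan n (set (cols V))"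
    using iterate by (auto simp: bpsd_id_iterate_def S_orthonormal_def)
  obtain N where N: "N \<in> carrier_mat k k" and QS: "mat_adjoint (Z * N) * S * (Z * N) = 1\<^sub>m k"
    and QH: "mat_adjoint (Z * N) * H * (Z * N) = mat_diag k (\<lambda>l. complex_of_real (\<theta> (Suc l)))"
    and ZHZ: "\<And>s. s < k \<Longrightarrow> (mat_adjoint Z * H * Z) *\<^sub>v col N s = complex_of_real (\<theta> (Suc s)) \<cdot>\<^sub>v col N s"
    and mono_\<theta>: "mono_on {1..k} \<theta>"
    using ritz_rotation[OF H S Z ritz] by blast
  define Q where "Q = Z * N"
  have Q: "Q \<in> carrier_mat n k" using Z(1) N by (simp add: Q_def)
  have colQ: "col Q s = Z *\<^sub>v col N s" if "s < k" for s
    unfolding Q_def by (rule col_mult2[OF Z(1) N that])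

  \<comment> \<open>The width is kept variable: interlacing takes the first two Ritz vectors, the
    filter the first \<open>t\<close>.\<close>
  define Y where "Y t = mat n t (\<lambda>(r, s). (mat_adjoint F * S * Q) $$ (r, s))" for t
  have Y: "Y t \<in> carrier_mat n t" for t by (simp add: Y_def)
  note coords = ritz_coordinates[OF H(1) S(1) F FS FH Q QS[folded Q_def] QH[folded Q_def] mono_\<theta>,
      folded Y_def]

  have Vc: "V \<in> carrier_mat n (Suc n - i)" unfolding V by (intro carrier_matI) (simp_all del: upt_Suc)
  have colV: "col V b = col F (i - 1 + b)" if "b < Suc n - i" for b
  proof -
    have "i - 1 + b < n" "Suc (i - 1 + b) = i + b" "i + b \<in> {1..n}" using that i by auto
    then show ?thesis using that uc[of "i + b"] by (simp add: colF V del: upt_Suc)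
  qed
  have "col Z q \<in> {V *\<^sub>v c | c. c \<in> carrier_vec (Suc n - i)}" if "q < k" for q
    using ZV that Z(1) unfolding cspan_cols[OF Vc, symmetric] by (auto simp: cols_def)
  then obtain J where J: "J \<in> carrier_mat (Suc n - i) k" and ZVJ: "Z = V * J"
    using factor_through_range[OF Vc Z(1)] by blast
  \<comment> \<open>\<open>Z\<close> factors through \<open>V\<close>, whose columns are those of
    \<open>F\<close> from \<open>i - 1\<close> on; the rows of \<open>mat_adjoint F * S\<close>
    before that annihilate them.\<close>
  have Y_ent: "(mat_adjoint F * S * Q) $$ (l, s) = 0" if "l < i - 1" "s < k" for l s
  proof -
    define A where "A = mat_adjoint F * S"
    have A: "A \<in> carrier_mat n n" unfolding A_def using F S by (intro carrier_matI) simp_all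
    have JN: "J * N \<in> carrier_mat (Suc n - i) k" using J N by simp
    have AQ: "A * Q = (A * V) * (J * N)"
      unfolding Q_def ZVJ using A Vc J N by (simp add: assoc_dim del: assoc_mult_mat)
    have l: "l < n" using that in1 by simp
    have "(A * V) $$ (l, b) = 0" if b: "b < Suc n - i" for b
    proof -
      have lb: "i - 1 + b < n" "l \<noteq> i - 1 + b" using b i \<open>l < i - 1\<close> by auto
      have "(A * V) $$ (l, b) = (A * F) $$ (l, i - 1 + b)"
        using A Vc F l b lb(1) by (simp add: colV del: One_nat_def)
      also have "\<dots> = 0" unfolding A_def FS using l lb by simp
      finally show ?thesis .
    qed
    then have row0: "row (A * V) l = 0\<^sub>v (Suc n - i)"
      using A Vc l by (intro eq_vecI) auto
    have "(A * V * (J * N)) $$ (l, s) = row (A * V) l \<bullet> col (J * N) s"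
      using A JN l \<open>s < k\<close> by (intro index_mult_mat(1)) auto
    also have "\<dots> = 0"
      unfolding row0 using carrier_matD(1)[OF JN] by (simp add: scalar_prod_def)
    finally have "(A * Q) $$ (l, s) = 0" unfolding AQ .
    then show ?thesis unfolding A_def .
  qed
  have Y_zero: "(Y t' *\<^sub>v c) $ l = 0" if "t' \<le> k" "c \<in> carrier_vec t'" "l < i - 1" for t' c l
  proof -
    have "l < n" using that in1 by simp
    then show ?thesis
      using that Y[of t'] Y_ent by (auto simp: scalar_prod_def Y_def simp del: index_mult_mat intro!: sum.neutral)
  qed

  have \<sigma>2: "\<sigma> < lam (i + 1)" using \<sigma> by simp
  have lam\<sigma>: "lam (Suc l) \<noteq> \<sigma>" if "l < n" for l
  proof (cases "Suc l \<le> i")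
    case True
    then have "lam (Suc l) \<le> lam i" using in1 by (intro mono_onD[OF mono]) auto
    then show ?thesis using \<sigma> by simp
  next
    case False
    then have "lam (i + 1) \<le> lam (Suc l)" using that by (intro mono_onD[OF mono]) auto
    then show ?thesis using \<sigma>2 by simp
  qed
  have \<theta>\<sigma>: "\<theta> (Suc s) \<noteq> \<sigma>" if "s < t" for s
  proof (cases "s = 0")
    case False
    then have k2: "1 \<le> (2 :: nat)" "2 \<le> k" "2 \<le> Suc s" "Suc s \<le> k" using that t by auto
    have "lam (i + 1) \<le> \<theta> 2"
      by (rule interlacing[OF mono i in1 Y Y_zero[OF k2(2)] coords(2,3)[OF k2(1,2)]])
    also have "\<dots> \<le> \<theta> (Suc s)" using k2 by (intro mono_onD[OF mono_\<theta>]) auto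
    finally show ?thesis using \<sigma>2 by simp
  qed (use \<theta>1 in simp)

  have gap: "lam j < lam (j + 1)" using \<theta>t by simp
  obtain a b c\<^sub>0 where ab: "0 \<le> a" "a \<le> b" "0 < b" and \<kappa>: "(\<kappa> / (2 - \<kappa>))\<^sup>2 = (a / b)\<^sup>2"
    and low: "\<And>l. l \<in> {i..j} \<Longrightarrow> b \<le> \<bar>1 / (lam l - \<sigma>) - c\<^sub>0\<bar>"
    and high: "\<And>l. l \<in> {j + 1..n} \<Longrightarrow> \<bar>1 / (lam l - \<sigma>) - c\<^sub>0\<bar> \<le> a"
    using shift_invert_separation[OF mono i ij j(2) \<sigma> gap] unfolding \<kappa>_def[symmetric] by blast
  \<comment> \<open>The values of the polynomial x - \<open>c\<^sub>0\<close> at the eigenvalues of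
    K S.\<close>
  define w where "w l = 1 / (lam l - \<sigma>) - c\<^sub>0" for l
  interpret filt: deflated_block n i j t lam w "\<theta> t" a b "Y t"
    by unfold_locales
      (use mono i t j \<theta>t ab low high Y Y_zero coords(2,3)[OF t] in \<open>auto simp: w_def\<close>)

  define P where "P = K * (H * Z - S * Z * (mat_adjoint Z * H * Z))"
  define X where "X = cspan n (set (cols U) \<union> set (cols Z) \<union> set (cols P))"
  have P: "P \<in> carrier_mat n k"
    unfolding P_def using K Z S H by (intro carrier_matI) simp_all
  have dimU: "dim_col U = i - 1" "U \<in> carrier_mat n (i - 1)"
    unfolding U by (auto intro: carrier_matI)
  have colU: "col U q = col F q" if "q < i - 1" for q
    using that in1 uc[of "Suc q"] by (simp add: colF U)
  have "\<exists>\<mu> p. mat_adjoint Z' * S * Z' = 1\<^sub>m k \<and> Z' \<in> carrier_mat n k \<and>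
      ritz_values n H S X \<mu> \<and> p permutes {1..k} \<and>
      (\<forall>l\<in>{1..k}. ritz_pair n H S X (\<mu> (i - 1 + p l)) (col Z' (l - 1)))"
    using step Z(1) dimU(1) unfolding bpsd_id_step_def Let_def P_def[symmetric] X_def[symmetric] S_orthonormal_def
    by (auto simp del: One_nat_def)
  then obtain \<mu> p where Z': "Z' \<in> carrier_mat n k" "mat_adjoint Z' * S * Z' = 1\<^sub>m k"
    and \<mu>: "ritz_values n H S X \<mu>" and p: "p permutes {1..k}"
    and pairs: "\<And>l. l \<in> {1..k} \<Longrightarrow> ritz_pair n H S X (\<mu> (i - 1 + p l)) (col Z' (l - 1))"
    by blast

  have UZP: "finite (set (cols U) \<union> set (cols Z) \<union> set (cols P))"
    "set (cols U) \<union> set (cols Z) \<union> set (cols P) \<subseteq> carrier_vec n"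
    using cols_dim[of U] cols_dim[of Z] cols_dim[of P] dimU Z P by auto

  define E where "E = F * filt.deflated_filter"
  have E: "E \<in> carrier_mat n j" using F filt.deflated_filter_carrier by (simp add: E_def)
  have Ec: "E *\<^sub>v c = F *\<^sub>v (filt.deflated_filter *\<^sub>v c)" "filt.deflated_filter *\<^sub>v c \<in> carrier_vec n"
    if "c \<in> carrier_vec j" for c
    using that F filt.deflated_filter_carrier mult_mat_vec_carrier[OF filt.deflated_filter_carrier that]
    by (auto simp: E_def assoc_mult_mat_vec_dim)
  have colE: "col E q \<in> X" if q: "q < j" for q
  proof (cases "q < i - 1")
    case True
    then have qn: "q < n" using in1 by simp
    have "col filt.deflated_filter q = unit_vec n q"
      using True q qn by (intro eq_vecI) (auto simp: filt.deflated_filter_def unit_vec_def)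
    then have "col E q = F *\<^sub>v unit_vec n q"
      unfolding E_def using col_mult2[OF F filt.deflated_filter_carrier q] by simp
    also have "\<dots> = U *\<^sub>v unit_vec (i - 1) q"
      using col_mult_unit[OF F qn] col_mult_unit[OF dimU(2) True] colU[OF True] by simp
    also have "\<dots> \<in> X"
      unfolding X_def by (rule cspan_mono_cols[OF dimU(2) _ unit_vec_carrier]) auto
    finally show ?thesis .
  next
    case False
    define s where "s = q - (i - 1)"
    have "s < t" using False q j(1) unfolding s_def by linarith
    then have s: "s < t" "s < k" using t(2) by simp_all
    define y where "y = col (Y t) s"
    have y: "y \<in> carrier_vec n" using Y[of t] unfolding y_def by (intro carrier_vecI) simp
    have Ns: "col N s \<in> carrier_vec k" using N by (intro carrier_vecI) simp
    have Fy: "F *\<^sub>v y = Z *\<^sub>v col N s"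
      unfolding y_def coords(1)[OF t s(1)] by (rule colQ[OF s(2)])
    have Zs: "Z *\<^sub>v col N s \<in> carrier_vec n" by (rule mult_mat_vec_carrier[OF Z(1) Ns])
    \<comment> \<open>Column \<open>s\<close> of \<open>N\<close> is an eigenvector of
      \<open>B\<close>. Combining the columns of \<open>P\<close> with it therefore turns the block
      residual into the residual of one sorted Ritz vector with its scalar Ritz value.\<close>
    define B where "B = mat_adjoint Z * H * Z"
    have B: "B \<in> carrier_mat k k" unfolding B_def using Z by (intro carrier_matI) simp_all
    have "P *\<^sub>v col N s = K *\<^sub>v ((H * Z - S * Z * B) *\<^sub>v col N s)"
      unfolding P_def B_def[symmetric] using K(1) H(1) S(1) Z(1) B N
      by (intro assoc_mult_mat_vec_dim) simp_all
    also have "(H * Z - S * Z * B) *\<^sub>v col N s = (H * Z) *\<^sub>v col N s - (S * Z * B) *\<^sub>v col N s"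
      by (rule minus_mult_distrib_mat_vec[OF mult_carrier_mat[OF H(1) Z(1)]
            mult_carrier_mat[OF mult_carrier_mat[OF S(1) Z(1)] B] Ns])
    also have "(H * Z) *\<^sub>v col N s = H *\<^sub>v (F *\<^sub>v y)"
      unfolding Fy using H(1) Z(1) N by (intro assoc_mult_mat_vec_dim) simp_all
    also have "(S * Z * B) *\<^sub>v col N s = S *\<^sub>v (Z *\<^sub>v (B *\<^sub>v col N s))"
      using S(1) Z(1) B N by (simp add: assoc_dim del: assoc_mult_mat assoc_mult_mat_vec)
    also have "\<dots> = complex_of_real (\<theta> (Suc s)) \<cdot>\<^sub>v (S *\<^sub>v (F *\<^sub>v y))"
      unfolding B_def ZHZ[OF s(2)] Fy using S(1) Z(1) N by (simp add: mult_smult_vec)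
    also have "K *\<^sub>v (H *\<^sub>v (F *\<^sub>v y) - complex_of_real (\<theta> (Suc s)) \<cdot>\<^sub>v (S *\<^sub>v (F *\<^sub>v y)))
        = F *\<^sub>v vec n (\<lambda>l. complex_of_real ((lam (Suc l) - \<theta> (Suc s)) / (lam (Suc l) - \<sigma>)) * y $ l)"
      by (rule preconditioned_residual[OF H(1) S(1) F eig K lam\<sigma> y])
    finally have Ps: "P *\<^sub>v col N s
      = F *\<^sub>v vec n (\<lambda>l. complex_of_real ((lam (Suc l) - \<theta> (Suc s)) / (lam (Suc l) - \<sigma>)) * y $ l)" (is "_ = F *\<^sub>v ?z") .
    \<comment> \<open>Solved from (lam - \<theta>) / (lam - \<sigma>) = 1 - (\<theta> - \<sigma>) /
      (lam - \<sigma>): this expresses 1 / (lam - \<sigma>) by 1 and the residual factor, provided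
      that \<theta> differs from \<sigma>.\<close>
    define \<alpha> where "\<alpha> = 1 / (\<theta> (Suc s) - \<sigma>) - c\<^sub>0"
    define \<beta> where "\<beta> = - (1 / (\<theta> (Suc s) - \<sigma>))"
    have "col filt.deflated_filter q = complex_of_real \<alpha> \<cdot>\<^sub>v y + complex_of_real \<beta> \<cdot>\<^sub>v ?z"
    proof (rule eq_vecI)
      fix l assume "l < dim_vec (complex_of_real \<alpha> \<cdot>\<^sub>v y + complex_of_real \<beta> \<cdot>\<^sub>v ?z)"
      then have l: "l < n" by simp
      have "w (Suc l) = \<alpha> + \<beta> * ((lam (Suc l) - \<theta> (Suc s)) / (lam (Suc l) - \<sigma>))"
        using lam\<sigma>[OF l] \<theta>\<sigma>[OF s(1)] by (simp add: w_def \<alpha>_def \<beta>_def divide_simps) (simp add: algebra_simps)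
      moreover have "col filt.deflated_filter q $ l = complex_of_real (w (Suc l)) * y $ l"
        using l q False s Y[of t] filt.deflated_filter_carrier unfolding y_def
        by (simp add: filt.deflated_filter_def s_def)
      ultimately show "col filt.deflated_filter q $ l = (complex_of_real \<alpha> \<cdot>\<^sub>v y + complex_of_real \<beta> \<cdot>\<^sub>v ?z) $ l"
        using l y by (simp add: distrib_right mult.assoc)
    qed (use y filt.deflated_filter_carrier in simp)
    then have "col E q = F *\<^sub>v (complex_of_real \<alpha> \<cdot>\<^sub>v y + complex_of_real \<beta> \<cdot>\<^sub>v ?z)"
      unfolding E_def using col_mult2[OF F filt.deflated_filter_carrier q] by simp
    also have "\<dots> = complex_of_real \<alpha> \<cdot>\<^sub>v (Z *\<^sub>v col N s) + complex_of_real \<beta> \<cdot>\<^sub>v (P *\<^sub>v col N s)"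
      unfolding Fy[symmetric] Ps using F y
      by (subst mult_add_distrib_mat_vec[of _ n n]) (simp_all add: mult_smult_vec)
    also have "\<dots> \<in> X"
      unfolding X_def
      by (intro cspan_lincomb UZP cspan_mono_cols[OF Z(1) _ Ns] cspan_mono_cols[OF P _ Ns]) auto
    finally show ?thesis .
  qed

  define \<rho> where "\<rho> = (a / b)\<^sup>2 * ((\<theta> t - lam j) / (lam (j + 1) - \<theta> t))"
  define M where "M = (lam j + \<rho> * lam (j + 1)) / (1 + \<rho>)"
  have \<rho>: "0 \<le> \<rho>" unfolding \<rho>_def using \<theta>t by (intro mult_nonneg_nonneg divide_nonneg_nonneg) auto
  have "1 \<le> j" using i ij by simp
  have "mono_on {1..j} \<mu> \<and> \<mu> j \<le> M"
  proof (rule ritz_upper_bound[OF H S \<mu> \<open>1 \<le> j\<close> E colE])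
    fix c :: "complex vec" assume c: "c \<in> carrier_vec j"
    show "c = 0\<^sub>v j" if "E *\<^sub>v c = 0\<^sub>v n"
    proof (rule filt.deflated_filter_kernel[OF c])
      show "filt.deflated_filter *\<^sub>v c = 0\<^sub>v n"
        using that by (intro orthonormal_kernel[OF S(1) F Ec(2)[OF c] FS]) (simp add: Ec(1)[OF c])
    qed
    show "Re ((H *\<^sub>v (E *\<^sub>v c)) \<bullet>c (E *\<^sub>v c)) \<le> M * Re ((S *\<^sub>v (E *\<^sub>v c)) \<bullet>c (E *\<^sub>v c))"
      unfolding Ec(1)[OF c] ritz_form[OF H(1) F Ec(2)[OF c] FH] orthonormal_form[OF S(1) F Ec(2)[OF c] FS]
        M_def \<rho>_def
      by (rule filt.deflated_filter_bound[OF c])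
  qed
  then have "\<theta>' t \<le> M"
    using new_ritz_value_bound[OF H S Z' p pairs ritz' t] unfolding j(1)[symmetric] by auto
  \<comment> \<open>\<open>M\<close> is a convex combination with positive weight on
    \<open>lam j\<close>. Staying below \<open>lam (j + 1)\<close> makes the denominator in the
    claim positive, so the bound on \<open>\<theta>' t\<close> may be converted into one on the
    quotient.\<close>
  moreover have "M < lam (j + 1)" using \<rho> gap by (simp add: M_def divide_simps algebra_simps)
  ultimately have "0 < lam (j + 1) - \<theta>' t" by simp
  moreover have "\<theta>' t * (1 + \<rho>) \<le> lam j + \<rho> * lam (j + 1)"
    using \<open>\<theta>' t \<le> M\<close> \<rho> by (simp add: M_def pos_le_divide_eq)
  ultimately have "(\<theta>' t - lam j) / (lam (j + 1) - \<theta>' t) \<le> \<rho>"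
    by (simp add: pos_divide_le_eq algebra_simps)
  then show ?thesis by (simp add: \<rho>_def \<kappa>)
qed

theorem theorem3p4:
  fixes n i k :: nat
    and H S K U V Z Z' :: "complex mat"
    and lam \<theta> \<theta>' :: "nat \<Rightarrow> real"
    and u :: "nat \<Rightarrow> complex vec"
    and \<sigma> :: real
  assumes "H \<in> carrier_mat n n" and "hermitian H"
    and "S \<in> carrier_mat n n" and "positive_definite S"
    and "pair_eigenvalues H S lam"
    and "1 \<le> i" and "i + 1 \<le> n" and "1 \<le> k"
    and "S_orthonormal_eigenbasis n H S lam u"
    and "U = mat_of_cols n (map u [1..<i])"
    and "V = mat_of_cols n (map u [i..<Suc n])"
    and "lam i < \<sigma>" and "\<sigma> < (lam i + lam (i + 1)) / 2"
    and "K \<in> carrier_mat n n"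
    and "inverts_mat (H - complex_of_real \<sigma> \<cdot>\<^sub>m S) K"
    and "inverts_mat K (H - complex_of_real \<sigma> \<cdot>\<^sub>m S)"
    and "bpsd_id_iterate n H S (cspan n (set (cols V))) k Z"
    and "bpsd_id_step n H S K U Z Z'"
    and "ritz_values n H S (cspan n (set (cols Z))) \<theta>"
    and "ritz_values n H S (cspan n (set (cols Z'))) \<theta>'"
  shows "(\<theta> 1 \<noteq> \<sigma> \<and> lam i < \<theta> 1 \<and> \<theta> 1 < lam (i + 1) \<longrightarrow>
            (let \<kappa> = ((lam i - \<sigma>) / (lam (i + 1) - \<sigma>)) *
                     ((lam n - lam (i + 1)) / (lam n - lam i))
             in (\<theta>' 1 - lam i) / (lam (i + 1) - \<theta>' 1)
                  \<le> (\<kappa> / (2 - \<kappa>))\<^sup>2 * ((\<theta> 1 - lam i) / (lam (i + 1) - \<theta> 1))))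
       \<and> (\<forall>t\<in>{2..k}. \<forall>j. j = i - 1 + t \<and> j + 1 \<le> n \<and>
            \<theta> 1 \<noteq> \<sigma> \<and> lam j < \<theta> t \<and> \<theta> t < lam (j + 1) \<longrightarrow>
            (let \<kappa> = ((lam j - \<sigma>) / (lam (j + 1) - \<sigma>)) *
                     ((lam n - lam (j + 1)) / (lam n - lam j))
             in (\<theta>' t - lam j) / (lam (j + 1) - \<theta>' t)
                  \<le> (\<kappa> / (2 - \<kappa>))\<^sup>2 * ((\<theta> t - lam j) / (lam (j + 1) - \<theta> t))))"
proof -
  note step = bpsd_id_ritz_value_step[OF assms(1-6,9-13,14,16-20)]
  have i: "i = i - 1 + 1" using assms(6) by simp
  show ?thesis
    unfolding Let_def
  proof (intro conjI impI ballI allI)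
    assume "\<theta> 1 \<noteq> \<sigma> \<and> lam i < \<theta> 1 \<and> \<theta> 1 < lam (i + 1)"
    then show "(\<theta>' 1 - lam i) / (lam (i + 1) - \<theta>' 1)
      \<le> ((lam i - \<sigma>) / (lam (i + 1) - \<sigma>) * ((lam n - lam (i + 1)) / (lam n - lam i)) /
          (2 - (lam i - \<sigma>) / (lam (i + 1) - \<sigma>) * ((lam n - lam (i + 1)) / (lam n - lam i))))\<^sup>2 *
        ((\<theta> 1 - lam i) / (lam (i + 1) - \<theta> 1))"
      using step[OF order_refl assms(8) i assms(7)] by blast
  next
    fix t j
    assume "t \<in> {2..k}" "j = i - 1 + t \<and> j + 1 \<le> n \<and> \<theta> 1 \<noteq> \<sigma> \<and> lam j < \<theta> t \<and> \<theta> t < lam (j + 1)"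
    then show "(\<theta>' t - lam j) / (lam (j + 1) - \<theta>' t)
      \<le> ((lam j - \<sigma>) / (lam (j + 1) - \<sigma>) * ((lam n - lam (j + 1)) / (lam n - lam j)) /
          (2 - (lam j - \<sigma>) / (lam (j + 1) - \<sigma>) * ((lam n - lam (j + 1)) / (lam n - lam j))))\<^sup>2 *
        ((\<theta> t - lam j) / (lam (j + 1) - \<theta> t))"
      by (intro step) auto
  qed
qed

end
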